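(* Let $\mathbb{S}_\infty=\{\theta\in[0,1]^{\mathbb{N}}:\sum_i\theta(i)=1\}$ be the parameter space, let the sample space be Baire space $\mathbb{N}^{\mathbb{N}}$, and let the likelihood $P_\theta$ be the countable product measure of $\theta$ (viewed as a probability measure on $\mathbb{N}$), so $P_\theta(\sigma)=\prod_{i<|\sigma|}\theta(\sigma(i))$. Then the set of pairs $(p,\theta)\in\mathcal{P}(\mathbb{S}_\infty)\times\mathbb{S}_\infty$ which are not classically consistent is effectively comeager.
   Context: $\mathbb{S}_\infty$ carries the subspace topology of the product topology on $[0,1]^{\mathbb{N}}$ with its natural computable Polish space structure, and $\mathcal{P}(\mathbb{S}_\infty)$ is the computable Polish space of Borel probability measures on $\mathbb{S}_\infty$ with the weak topology. A subset of a computable Polish space is effectively comeager if it contains $\bigcap_n W_n$ for some computable sequence of c.e. open sets $W_n$, each of which is dense. For a prior $p\in\mathcal{P}(\mathbb{S}_\infty)$ and a finite string $\sigma\in\mathbb{N}^{<\mathbb{N}}$, the posterior is $p(A\mid\sigma)=\int_AP_\theta(\sigma)\,dp(\theta)/\int_{\mathbb{S}_\infty}P_\theta(\sigma)\,dp(\theta)$ when the denominator is nonzero and $0$ otherwise. A pair $(p,\theta)$ is classically consistent if $P_\theta$ is a probability measure and for every open $U\subseteq\mathbb{S}_\infty$, $\lim_n p(U\mid x\upharpoonright n)=I_U(\theta)$ for $P_\theta$-a.e. $x\in\mathbb{N}^{\mathbb{N}}$, where $x\upharpoonright n$ is the first $n$ entries of $x$. *)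

theory Defs
  imports "HOL-Probability.Probability" "HOL-Library.Nat_Bijection"
begin

section \<open>Computability on the natural numbers\<close>

text \<open>
  Total recursive functions: closed under minimization of regular functions only, hence total.
  The first parameter is the arity; the values on lists of any other length are irrelevant.
\<close>

inductive recursive_fn :: "nat \<Rightarrow> (nat list \<Rightarrow> nat) \<Rightarrow> bool" where
  zero: "recursive_fn k (\<lambda>xs. 0)"
| succ: "recursive_fn 1 (\<lambda>xs. Suc (xs ! 0))"
| proj: "i < k \<Longrightarrow> recursive_fn k (\<lambda>xs. xs ! i)"
| comp: "\<lbrakk>recursive_fn (length gs) f; \<And>g. g \<in> set gs \<Longrightarrow> recursive_fn k g\<rbrakk>
    \<Longrightarrow> recursive_fn k (\<lambda>xs. f (map (\<lambda>g. g xs) gs))"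
| prim: "\<lbrakk>recursive_fn k f; recursive_fn (Suc (Suc k)) g\<rbrakk>
    \<Longrightarrow> recursive_fn (Suc k) (\<lambda>xs. rec_nat (f (tl xs)) (\<lambda>n r. g (n # r # tl xs)) (hd xs))"
| mu: "\<lbrakk>recursive_fn (Suc k) f; \<And>xs. length xs = k \<Longrightarrow> \<exists>n. f (n # xs) = 0\<rbrakk>
    \<Longrightarrow> recursive_fn k (\<lambda>xs. LEAST n. f (n # xs) = 0)"

definition ce_relation :: "nat \<Rightarrow> (nat list \<Rightarrow> bool) \<Rightarrow> bool" where
  "ce_relation k R \<longleftrightarrow>
     (\<exists>f. recursive_fn (Suc k) f \<and> (\<forall>xs. length xs = k \<longrightarrow> (R xs \<longleftrightarrow> (\<exists>m. f (m # xs) = 0))))"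

text \<open>An enumeration (with repetitions) of the positive rationals.\<close>

definition rat_radius :: "nat \<Rightarrow> real" where
  "rat_radius j = (case prod_decode j of (a, b) \<Rightarrow> real (a + 1) / real (b + 1))"


section \<open>Presented Polish spaces\<close>

text \<open>
  The data of a computable Polish space: a (complete) metric together with a dense sequence of
  ideal points on which the metric is computable.
\<close>

record 'a presented_space =
  met :: "'a metric"
  ideal :: "nat \<Rightarrow> 'a"

text \<open>
  A computable sequence of c.e. open sets: uniformly in \<open>n\<close>, the set \<open>W n\<close> is the union of a
  c.e. family of balls with ideal centres and positive rational radii.
\<close>

definition computable_ce_open_seq :: "'a presented_space \<Rightarrow> (nat \<Rightarrow> 'a set) \<Rightarrow> bool" where
  "computable_ce_open_seq X W \<longleftrightarrow>
     (\<exists>R. ce_relation 3 R \<and>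
       (\<forall>n. W n = \<Union> {mball_of (met X) (ideal X i) (rat_radius j) | i j. R [n, i, j]}))"

definition effectively_comeager :: "'a presented_space \<Rightarrow> 'a set \<Rightarrow> bool" where
  "effectively_comeager X C \<longleftrightarrow>
     C \<subseteq> mspace (met X) \<and>
     (\<exists>W. computable_ce_open_seq X W \<and>
          (\<forall>n. mtopology_of (met X) closure_of W n = mspace (met X)) \<and>
          (\<Inter>n. W n) \<subseteq> C)"

definition prod_presented ::
    "'a presented_space \<Rightarrow> 'b presented_space \<Rightarrow> ('a \<times> 'b) presented_space" where
  "prod_presented X Y =
     \<lparr>met = prod_metric (met X) (met Y),
      ideal = (\<lambda>c. case prod_decode c of (i, j) \<Rightarrow> (ideal X i, ideal Y j))\<rparr>"


section \<open>The parameter space\<close>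

definition S_inf :: "(nat \<Rightarrow> real) set" where
  "S_inf = {\<theta>. (\<forall>i. \<theta> i \<in> {0..1}) \<and> \<theta> sums 1}"

text \<open>
  The product metric is not complete on \<^term>\<open>S_inf\<close>; the \<open>l\<^sub>1\<close> metric is, and it induces the
  subspace topology of the product topology (lemma \<open>mtopology_of_S_inf_metric\<close> below).
\<close>

definition l1_dist :: "(nat \<Rightarrow> real) \<Rightarrow> (nat \<Rightarrow> real) \<Rightarrow> real" where
  "l1_dist \<theta> \<eta> = (\<Sum>\<^sub>\<infinity>i. \<bar>\<theta> i - \<eta> i\<bar>)"

definition S_inf_metric :: "(nat \<Rightarrow> real) metric" where
  "S_inf_metric = metric (S_inf, l1_dist)"

text \<open>
  The finitely supported rational probability vectors: the code of a list of weights denotes the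
  normalized list, with the point mass at 0 as default if all weights vanish.
\<close>

definition rat_prob_vector :: "nat \<Rightarrow> nat \<Rightarrow> real" where
  "rat_prob_vector c i =
     (let ws = list_decode c in
      if sum_list ws = 0 then (if i = 0 then 1 else 0)
      else if i < length ws then real (ws ! i) / real (sum_list ws) else 0)"

definition S_inf_space :: "(nat \<Rightarrow> real) presented_space" where
  "S_inf_space = \<lparr>met = S_inf_metric, ideal = rat_prob_vector\<rparr>"

text \<open>A parameter viewed as a measure on the natural numbers.\<close>

definition vector_measure :: "(nat \<Rightarrow> real) \<Rightarrow> nat measure" where
  "vector_measure \<theta> = density (count_space UNIV) (\<lambda>i. ennreal (\<theta> i))"


section \<open>Spaces of Borel probability measures\<close>

definition metric_borel :: "'a metric \<Rightarrow> 'a measure" where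
  "metric_borel m = sigma (mspace m) {U. openin (mtopology_of m) U}"

definition prob_measures :: "'a metric \<Rightarrow> 'a measure set" where
  "prob_measures m = {p. prob_space p \<and> sets p = sets (metric_borel m)}"

definition thickening :: "'a metric \<Rightarrow> real \<Rightarrow> 'a set \<Rightarrow> 'a set" where
  "thickening m \<epsilon> A = (\<Union>a\<in>A. mball_of m a \<epsilon>)"

text \<open>
  The Prokhorov metric, which metrizes the weak topology when the underlying space is separable,
  completely so when it is Polish. Values outside the space of probability measures are
  set to 0 because the library's metrics are required to be nonnegative everywhere.
\<close>

definition prokhorov_dist :: "'a metric \<Rightarrow> 'a measure \<Rightarrow> 'a measure \<Rightarrow> real" where
  "prokhorov_dist m p q =
     (if p \<in> prob_measures m \<and> q \<in> prob_measures m
      then Inf {\<epsilon>. 0 < \<epsilon> \<and> (\<forall>A\<in>sets (metric_borel m).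
             measure p A \<le> measure q (thickening m \<epsilon> A) + \<epsilon> \<and>
             measure q A \<le> measure p (thickening m \<epsilon> A) + \<epsilon>)}
      else 0)"

definition prokhorov_metric :: "'a metric \<Rightarrow> 'a measure metric" where
  "prokhorov_metric m = metric (prob_measures m, prokhorov_dist m)"

text \<open>
  Ideal points: the finite rational mixtures of point masses at ideal points. The code \<open>c\<close> denotes
  the mixture that gives weight \<open>rat_prob_vector c i\<close> to the \<open>i\<close>-th ideal point.
\<close>

definition prob_presented :: "'a presented_space \<Rightarrow> 'a measure presented_space" where
  "prob_presented X =
     \<lparr>met = prokhorov_metric (met X),
      ideal = (\<lambda>c. distr (vector_measure (rat_prob_vector c)) (metric_borel (met X)) (ideal X))\<rparr>"


section \<open>Bayesian consistency\<close>

definition P_measure :: "(nat \<Rightarrow> real) \<Rightarrow> (nat \<Rightarrow> nat) measure" where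
  "P_measure \<theta> = PiM UNIV (\<lambda>_. vector_measure \<theta>)"

definition likelihood :: "(nat \<Rightarrow> real) \<Rightarrow> nat list \<Rightarrow> real" where
  "likelihood \<theta> \<sigma> = (\<Prod>i<length \<sigma>. \<theta> (\<sigma> ! i))"

definition posterior :: "(nat \<Rightarrow> real) measure \<Rightarrow> (nat \<Rightarrow> real) set \<Rightarrow> nat list \<Rightarrow> real" where
  "posterior p A \<sigma> =
     (if (LINT \<theta>|p. likelihood \<theta> \<sigma>) \<noteq> 0
      then (LINT \<theta>:A|p. likelihood \<theta> \<sigma>) / (LINT \<theta>|p. likelihood \<theta> \<sigma>)
      else 0)"

definition classically_consistent :: "(nat \<Rightarrow> real) measure \<Rightarrow> (nat \<Rightarrow> real) \<Rightarrow> bool" where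
  "classically_consistent p \<theta> \<longleftrightarrow>
     prob_space (P_measure \<theta>) \<and>
     (\<forall>U. openin (top_of_set S_inf) U \<longrightarrow>
       (AE x in P_measure \<theta>.
          (\<lambda>n. posterior p U (map x [0..<n])) \<longlonglongrightarrow> indicator U \<theta>))"


section \<open>Well-definedness\<close>

lemma S_inf_nonneg: "\<theta> \<in> S_inf \<Longrightarrow> 0 \<le> \<theta> i"
  by (auto simp: S_inf_def)

lemma S_inf_summable: "\<theta> \<in> S_inf \<Longrightarrow> summable \<theta>"
  by (auto simp: S_inf_def sums_iff)

lemma S_inf_suminf: "\<theta> \<in> S_inf \<Longrightarrow> suminf \<theta> = 1"
  by (auto simp: S_inf_def sums_iff)

lemma S_inf_diff_summable:
  assumes "\<theta> \<in> S_inf" "\<eta> \<in> S_inf"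
  shows "summable (\<lambda>i. \<bar>\<theta> i - \<eta> i\<bar>)"
proof (rule summable_comparison_test')
  show "summable (\<lambda>i. \<theta> i + \<eta> i)"
    using assms by (intro summable_add S_inf_summable)
  show "norm \<bar>\<theta> i - \<eta> i\<bar> \<le> \<theta> i + \<eta> i" for i
    using S_inf_nonneg[OF assms(1), of i] S_inf_nonneg[OF assms(2), of i] by simp
qed

lemma l1_dist_eq_suminf:
  assumes "\<theta> \<in> S_inf" "\<eta> \<in> S_inf"
  shows "l1_dist \<theta> \<eta> = (\<Sum>i. \<bar>\<theta> i - \<eta> i\<bar>)"
proof -
  have "((\<lambda>i. \<bar>\<theta> i - \<eta> i\<bar>) has_sum (\<Sum>i. \<bar>\<theta> i - \<eta> i\<bar>)) UNIV"
    using S_inf_diff_summable[OF assms]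
    by (intro norm_summable_imp_has_sum summable_sums) auto
  then show ?thesis
    unfolding l1_dist_def by (rule infsumI)
qed

lemma Metric_space_S_inf: "Metric_space S_inf l1_dist"
proof
  show "0 \<le> l1_dist \<theta> \<eta>" for \<theta> \<eta>
    unfolding l1_dist_def by (rule infsum_nonneg) simp
  show "l1_dist \<theta> \<eta> = l1_dist \<eta> \<theta>" for \<theta> \<eta>
    unfolding l1_dist_def by (simp add: abs_minus_commute)
  show "l1_dist \<theta> \<eta> = 0 \<longleftrightarrow> \<theta> = \<eta>" if "\<theta> \<in> S_inf" "\<eta> \<in> S_inf" for \<theta> \<eta>
    using suminf_eq_zero_iff[OF S_inf_diff_summable[OF that]]
    by (auto simp: l1_dist_eq_suminf[OF that])
  show "l1_dist \<theta> \<zeta> \<le> l1_dist \<theta> \<eta> + l1_dist \<eta> \<zeta>"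
    if t: "\<theta> \<in> S_inf" "\<eta> \<in> S_inf" "\<zeta> \<in> S_inf" for \<theta> \<eta> \<zeta>
    unfolding l1_dist_eq_suminf[OF t(1,3)] l1_dist_eq_suminf[OF t(1,2)] l1_dist_eq_suminf[OF t(2,3)]
    by (subst suminf_add)
       (auto intro!: suminf_le summable_add S_inf_diff_summable t)
qed

lemma mspace_S_inf_metric [simp]: "mspace S_inf_metric = S_inf"
  and mdist_S_inf_metric [simp]: "mdist S_inf_metric = l1_dist"
  unfolding S_inf_metric_def
  using Metric_space_S_inf by (simp_all add: Metric_space.mspace_metric Metric_space.mdist_metric)

lemma coord_le_l1_dist:
  assumes "\<theta> \<in> S_inf" "\<eta> \<in> S_inf"
  shows "\<bar>\<theta> i - \<eta> i\<bar> \<le> l1_dist \<theta> \<eta>"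
  unfolding l1_dist_eq_suminf[OF assms]
  using sum_le_suminf[OF S_inf_diff_summable[OF assms], of "{i}"] by simp

lemma l1_dist_le_initial:
  assumes "\<theta> \<in> S_inf" "\<eta> \<in> S_inf"
  shows "l1_dist \<theta> \<eta> \<le> 2 * (\<Sum>i<N. \<bar>\<theta> i - \<eta> i\<bar>) + 2 * (1 - (\<Sum>i<N. \<theta> i))"
proof -
  have tail: "(\<Sum>i. \<zeta> (i + N)) = 1 - (\<Sum>i<N. \<zeta> i)" if "\<zeta> \<in> S_inf" for \<zeta>
    using suminf_split_initial_segment[OF S_inf_summable[OF that], of N] S_inf_suminf[OF that]
    by simp
  have sh: "summable (\<lambda>i. \<zeta> (i + N))" if "\<zeta> \<in> S_inf" for \<zeta>
    using S_inf_summable[OF that] by (simp add: summable_iff_shift)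
  have "(\<Sum>i. \<bar>\<theta> (i + N) - \<eta> (i + N)\<bar>) \<le> (\<Sum>i. \<theta> (i + N) + \<eta> (i + N))"
  proof (rule suminf_le)
    show "\<bar>\<theta> (i + N) - \<eta> (i + N)\<bar> \<le> \<theta> (i + N) + \<eta> (i + N)" for i
      using S_inf_nonneg[OF assms(1), of "i + N"] S_inf_nonneg[OF assms(2), of "i + N"] by simp
    show "summable (\<lambda>i. \<bar>\<theta> (i + N) - \<eta> (i + N)\<bar>)"
      using S_inf_diff_summable[OF assms] summable_iff_shift[of "\<lambda>i. \<bar>\<theta> i - \<eta> i\<bar>" N] by simp
    show "summable (\<lambda>i. \<theta> (i + N) + \<eta> (i + N))"
      using assms by (intro summable_add sh)
  qed
  also have "\<dots> = (1 - (\<Sum>i<N. \<theta> i)) + (1 - (\<Sum>i<N. \<eta> i))"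
    using suminf_add[OF sh[OF assms(1)] sh[OF assms(2)]] tail[OF assms(1)] tail[OF assms(2)] by simp
  also have "(\<Sum>i<N. \<theta> i) - (\<Sum>i<N. \<eta> i) \<le> (\<Sum>i<N. \<bar>\<theta> i - \<eta> i\<bar>)"
    by (simp add: sum_subtractf[symmetric] sum_mono)
  then have "(1 - (\<Sum>i<N. \<theta> i)) + (1 - (\<Sum>i<N. \<eta> i))
      \<le> 2 * (1 - (\<Sum>i<N. \<theta> i)) + (\<Sum>i<N. \<bar>\<theta> i - \<eta> i\<bar>)"
    by simp
  finally show ?thesis
    using suminf_split_initial_segment[OF S_inf_diff_summable[OF assms], of N]
      l1_dist_eq_suminf[OF assms] by simp
qed

lemma mtopology_of_S_inf_metric: "mtopology_of S_inf_metric = top_of_set S_inf"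
proof -
  interpret Metric_space S_inf l1_dist by (rule Metric_space_S_inf)
  have mt: "mtopology_of S_inf_metric = mtopology"
    by (simp add: mtopology_of_def)
  show ?thesis
    unfolding mt topology_eq
  proof (intro allI iffI)
    fix U assume U: "openin mtopology U"
    show "openin (top_of_set S_inf) U"
    proof (subst openin_subopen, intro ballI)
      fix \<theta> assume "\<theta> \<in> U"
      with U obtain r where r: "r > 0" "mball \<theta> r \<subseteq> U" and \<theta>: "\<theta> \<in> S_inf"
        unfolding openin_mtopology by blast
      have "\<forall>\<^sub>F N in sequentially. (\<Sum>i<N. \<theta> i) > 1 - r / 4"
        using \<theta> r(1) by (intro order_tendstoD(1)[of _ 1]) (auto simp: S_inf_def sums_def)
      then obtain N where N: "(\<Sum>i<N. \<theta> i) > 1 - r / 4"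
        by (auto simp: eventually_sequentially)
      define V where "V = {\<eta>. (\<Sum>i<N. \<bar>\<theta> i - \<eta> i\<bar>) < r / 4}"
      have "open V"
        unfolding V_def by (intro open_Collect_less continuous_intros continuous_on_coordinatewise_then_product) auto
      moreover have "\<theta> \<in> V"
        using r(1) by (simp add: V_def)
      moreover have "S_inf \<inter> V \<subseteq> U"
      proof
        fix \<eta> assume \<eta>: "\<eta> \<in> S_inf \<inter> V"
        then have "l1_dist \<theta> \<eta> < r"
          using l1_dist_le_initial[OF \<theta>, of \<eta> N] N by (auto simp: V_def)
        with \<theta> \<eta> r(2) show "\<eta> \<in> U" by auto
      qed
      ultimately show "\<exists>T. openin (top_of_set S_inf) T \<and> \<theta> \<in> T \<and> T \<subseteq> U"
        using \<theta> by (intro exI[of _ "S_inf \<inter> V"]) (auto intro: openin_open_Int)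
    qed
  next
    fix U assume "openin (top_of_set S_inf) U"
    then obtain T where T: "open T" "U = S_inf \<inter> T"
      by (auto simp: openin_open)
    show "openin mtopology U"
      unfolding openin_mtopology
    proof (intro conjI allI impI)
      show "U \<subseteq> S_inf" using T by auto
      fix \<theta> assume "\<theta> \<in> U"
      with T have \<theta>: "\<theta> \<in> S_inf" "\<theta> \<in> T" by auto
      from product_topology_open_contains_basis[OF T(1)[unfolded open_fun_def] \<theta>(2)]
      obtain X where X: "\<theta> \<in> Pi\<^sub>E UNIV X" "\<And>i. openin euclidean (X i)"
        "finite {i. X i \<noteq> topspace euclidean}" "Pi\<^sub>E UNIV X \<subseteq> T"
        by auto
      have "\<exists>e>0. \<forall>y. \<bar>\<theta> i - y\<bar> < e \<longrightarrow> y \<in> X i" for i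
      proof -
        have "open (X i)" using X(2)[of i] by (simp only: open_openin)
        moreover have "\<theta> i \<in> X i" using X(1) by (rule PiE_mem) simp
        ultimately obtain e where "e > 0" "ball (\<theta> i) e \<subseteq> X i"
          by (rule openE)
        then show ?thesis
          by (intro exI[of _ e]) (auto simp: dist_real_def subset_iff)
      qed
      then obtain e where e: "\<And>i. e i > 0" "\<And>i y. \<bar>\<theta> i - y\<bar> < e i \<Longrightarrow> y \<in> X i"
        by metis
      define J where "J = {i. X i \<noteq> UNIV}"
      have J: "finite J" using X(3) by (simp add: J_def)
      define r where "r = Min (insert 1 (e ` J))"
      have r: "r > 0" "\<And>i. i \<in> J \<Longrightarrow> r \<le> e i"
        using J e(1) by (auto simp: r_def)
      have "mball \<theta> r \<subseteq> U"
      proof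
        fix \<eta> assume "\<eta> \<in> mball \<theta> r"
        then have \<eta>: "\<eta> \<in> S_inf" "l1_dist \<theta> \<eta> < r" by auto
        have "\<eta> i \<in> X i" for i
        proof (cases "i \<in> J")
          case True
          then show ?thesis
            using coord_le_l1_dist[OF \<theta>(1) \<eta>(1), of i] \<eta>(2) r(2)[of i] e(2)[of i] by force
        qed (auto simp: J_def)
        with X(4) \<eta>(1) T(2) show "\<eta> \<in> U" by (auto simp: PiE_def Pi_def)
      qed
      with r(1) show "\<exists>r>0. mball \<theta> r \<subseteq> U" by blast
    qed
  qed
qed

lemma space_metric_borel [simp]: "space (metric_borel m) = mspace m"
  unfolding metric_borel_def by (rule space_measure_of) (use openin_subset in fastforce)

lemma sets_metric_borel:
  "sets (metric_borel m) = sigma_sets (mspace m) {U. openin (mtopology_of m) U}"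
  unfolding metric_borel_def by (rule sets_measure_of) (use openin_subset in fastforce)

lemma sets_metric_borel_S_inf:
  "sets (metric_borel S_inf_metric) = sets (restrict_space borel S_inf)"
proof -
  have vim: "(\<lambda>x. x) -` A \<inter> S_inf = S_inf \<inter> A" for A :: "(nat \<Rightarrow> real) set"
    by auto
  have "sets (restrict_space borel S_inf) = {S_inf \<inter> A | A. A \<in> sigma_sets UNIV {T. open T}}"
    by (auto simp: sets_restrict_space borel_def)
  also have "\<dots> = sigma_sets S_inf {S_inf \<inter> A | A. A \<in> {T. open T}}"
    using sigma_sets_vimage_commute[of "\<lambda>x. x" S_inf UNIV "{T. open T}"] unfolding vim by blast
  also have "{S_inf \<inter> A | A. A \<in> {T. open T}} = {U. openin (top_of_set S_inf) U}"
    by (auto simp: openin_open)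
  finally show ?thesis
    by (simp add: sets_metric_borel mtopology_of_S_inf_metric)
qed

lemma openin_in_metric_borel: "openin (mtopology_of m) U \<Longrightarrow> U \<in> sets (metric_borel m)"
  by (auto simp: sets_metric_borel)

lemma openin_thickening: "openin (mtopology_of m) (thickening m \<epsilon> A)"
  unfolding thickening_def by (intro openin_Union) (auto simp: mball_of_def mtopology_of_def
      intro: Metric_space.openin_mball[OF Metric_space_mspace_mdist])

lemma thickening_mono: "\<epsilon> \<le> \<delta> \<Longrightarrow> thickening m \<epsilon> A \<subseteq> thickening m \<delta> A"
  unfolding thickening_def by fastforce

lemma thickening_thickening:
  "thickening m \<delta> (thickening m \<epsilon> A) \<subseteq> thickening m (\<epsilon> + \<delta>) A"
proof
  interpret Metric_space "mspace m" "mdist m" by (rule Metric_space_mspace_mdist)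
  fix x assume "x \<in> thickening m \<delta> (thickening m \<epsilon> A)"
  then obtain a y where a: "a \<in> A" "a \<in> mspace m" "y \<in> mspace m" "x \<in> mspace m"
    "mdist m a y < \<epsilon>" "mdist m y x < \<delta>"
    by (auto simp: thickening_def)
  then have "mdist m a x < \<epsilon> + \<delta>"
    using triangle[of a y x] by linarith
  with a show "x \<in> thickening m (\<epsilon> + \<delta>) A"
    by (auto simp: thickening_def)
qed

lemma Inter_thickening_closed:
  assumes "closedin (mtopology_of m) C"
  shows "(\<Inter>n. thickening m (1 / real (Suc n)) C) = C"
proof -
  interpret Metric_space "mspace m" "mdist m" by (rule Metric_space_mspace_mdist)
  have C: "closedin mtopology C" using assms by (simp add: mtopology_of_def)
  have sub: "C \<subseteq> mspace m" using closedin_subset[OF C] by simp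
  show ?thesis
  proof (intro equalityI subsetI)
    fix x assume "x \<in> C"
    with sub show "x \<in> (\<Inter>n. thickening m (1 / real (Suc n)) C)"
      by (auto simp: thickening_def intro!: bexI[of _ x])
  next
    fix x assume x: "x \<in> (\<Inter>n. thickening m (1 / real (Suc n)) C)"
    then have xm: "x \<in> mspace m" by (auto simp: thickening_def)
    have "\<exists>y\<in>C. y \<in> mball x r" if "r > 0" for r
    proof -
      obtain n where n: "1 / real (Suc n) < r"
        using nat_approx_posE[OF \<open>r > 0\<close>] by blast
      from x obtain a where "a \<in> C" "a \<in> mspace m" "mdist m a x < 1 / real (Suc n)"
        by (fastforce simp: thickening_def)
      with n xm show ?thesis by (intro bexI[of _ a]) (auto simp: commute)
    qed
    then have "x \<in> mtopology closure_of C"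
      using xm by (simp add: metric_closure_of)
    with C show "x \<in> C" by (simp add: closure_of_closedin)
  qed
qed

lemma Metric_space_prokhorov: "Metric_space (prob_measures m) (prokhorov_dist m)"
proof -
  define V where "V p q = {\<epsilon>. 0 < \<epsilon> \<and> (\<forall>A\<in>sets (metric_borel m).
             measure p A \<le> measure q (thickening m \<epsilon> A) + \<epsilon> \<and>
             measure q A \<le> measure p (thickening m \<epsilon> A) + \<epsilon>)}" for p q :: "'a measure"
  have d: "prokhorov_dist m p q = Inf (V p q)"
    if "p \<in> prob_measures m" "q \<in> prob_measures m" for p q
    using that by (simp add: prokhorov_dist_def V_def)
  have one: "1 \<in> V p q" if "p \<in> prob_measures m" "q \<in> prob_measures m" for p q
  proof -
    have "measure p A \<le> 1" "measure q A \<le> 1" for A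
      using that by (auto simp: prob_measures_def intro: prob_space.prob_le_1)
    then show ?thesis
      unfolding V_def by (auto intro: order_trans[OF _ le_add_same_cancel2[THEN iffD2]])
  qed
  have bdd: "bdd_below (V p q)" for p q
    by (rule bdd_belowI[of _ 0]) (auto simp: V_def)
  have nonneg: "0 \<le> Inf (V p q)" if "p \<in> prob_measures m" "q \<in> prob_measures m" for p q
    proof (rule cInf_greatest)
    show "V p q \<noteq> {}" using one[OF that] by blast
  qed (auto simp: V_def)
  have meas_thick: "thickening m \<epsilon> A \<in> sets p" if "p \<in> prob_measures m" for p \<epsilon> A
    using openin_in_metric_borel[OF openin_thickening] that by (auto simp: prob_measures_def)
  have mono: "measure p A \<le> measure p B"
    if "p \<in> prob_measures m" "A \<subseteq> B" "B \<in> sets p" for p A B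
    using that by (auto simp: prob_measures_def prob_space_def intro: finite_measure.finite_measure_mono)
  have closed_le: "measure p C \<le> measure q C"
    if pq: "p \<in> prob_measures m" "q \<in> prob_measures m" and z: "Inf (V p q) = 0"
      and C: "closedin (mtopology_of m) C" for p q C
  proof -
    have q: "finite_measure q" using pq by (simp add: prob_measures_def prob_space_def)
    have Cb: "C \<in> sets (metric_borel m)"
    proof -
      have "mspace m - C \<in> sets (metric_borel m)"
        using C by (intro openin_in_metric_borel) (simp add: closedin_def)
      then have "mspace m - (mspace m - C) \<in> sets (metric_borel m)"
        using sets.compl_sets by fastforce
      moreover have "mspace m - (mspace m - C) = C"
        using closedin_subset[OF C] by auto
      ultimately show ?thesis by simp
    qed
    have le: "measure p C \<le> measure q (thickening m (1 / real (Suc n)) C) + 1 / real (Suc n)" for n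
    proof -
      have "Inf (V p q) < 1 / real (Suc n)" using z by simp
      then obtain \<epsilon> where e: "\<epsilon> \<in> V p q" "\<epsilon> < 1 / real (Suc n)"
        using cInf_less_iff[OF _ bdd] one[OF pq] by (metis empty_iff)
      then have "measure p C \<le> measure q (thickening m \<epsilon> C) + \<epsilon>"
        using Cb by (auto simp: V_def)
      also have "measure q (thickening m \<epsilon> C) \<le> measure q (thickening m (1 / real (Suc n)) C)"
        using e by (intro mono pq thickening_mono meas_thick) auto
      finally show ?thesis using e by simp
    qed
    have "(\<lambda>n. measure q (thickening m (1 / real (Suc n)) C))
        \<longlonglongrightarrow> measure q (\<Inter>n. thickening m (1 / real (Suc n)) C)"
      using meas_thick[OF pq(2)]
      by (intro finite_measure.finite_Lim_measure_decseq[OF q])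
         (auto intro!: decseq_SucI thickening_mono simp del: of_nat_Suc simp: frac_le)
    then have "(\<lambda>n. measure q (thickening m (1 / real (Suc n)) C) + 1 / real (Suc n))
        \<longlonglongrightarrow> measure q C + 0"
      unfolding Inter_thickening_closed[OF C]
      by (intro tendsto_add LIMSEQ_inverse_real_of_nat[unfolded inverse_eq_divide])
    then have "measure p C \<le> measure q C + 0"
      by (rule LIMSEQ_le_const) (use le in blast)
    then show ?thesis by simp
  qed
  have V_commute: "V p q = V q p" for p q
    by (auto simp: V_def)
  show ?thesis
  proof
    show "0 \<le> prokhorov_dist m p q" for p q
      using nonneg d by (cases "p \<in> prob_measures m \<and> q \<in> prob_measures m")
        (auto simp: prokhorov_dist_def)
    show "prokhorov_dist m p q = prokhorov_dist m q p" for p q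
      using d V_commute by (cases "p \<in> prob_measures m \<and> q \<in> prob_measures m")
        (auto simp: prokhorov_dist_def)
    show "prokhorov_dist m p q = 0 \<longleftrightarrow> p = q"
      if pq: "p \<in> prob_measures m" "q \<in> prob_measures m" for p q
    proof
      assume z: "prokhorov_dist m p q = 0"
      have P: "prob_space p" "prob_space q" and
        S: "sets p = sets (metric_borel m)" "sets q = sets (metric_borel m)"
        using pq by (auto simp: prob_measures_def)
      have sp: "space p = mspace m" "space q = mspace m"
        using sets_eq_imp_space_eq[OF S(1)] sets_eq_imp_space_eq[OF S(2)] by simp_all
      have eq: "measure p C = measure q C" if "closedin (mtopology_of m) C" for C
        using closed_le[OF pq _ that] closed_le[OF pq(2,1) _ that] z d[OF pq] V_commute
        by (metis order_antisym)
      have eqo: "emeasure p U = emeasure q U" if U: "openin (mtopology_of m) U" for U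
      proof -
        have "measure p (mspace m - U) = measure q (mspace m - U)"
          using U by (intro eq) (simp add: openin_closedin_eq)
        moreover have "U \<in> sets (metric_borel m)" using U by (rule openin_in_metric_borel)
        ultimately have "measure p U = measure q U"
          using prob_space.prob_compl[OF P(1), of U] prob_space.prob_compl[OF P(2), of U]
          by (simp add: sp S)
        then show ?thesis
          using P by (simp add: prob_space_def finite_measure.emeasure_eq_measure)
      qed
      show "p = q"
      proof (rule measure_eqI_generator_eq[where \<Omega> = "mspace m" and E = "{U. openin (mtopology_of m) U}"
            and A = "\<lambda>_. mspace m"])
        show "Int_stable {U. openin (mtopology_of m) U}" by (auto simp: Int_stable_def)
        show "{U. openin (mtopology_of m) U} \<subseteq> Pow (mspace m)"
          using openin_subset by fastforce
        show "sets p = sigma_sets (mspace m) {U. openin (mtopology_of m) U}"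
          "sets q = sigma_sets (mspace m) {U. openin (mtopology_of m) U}"
          using S by (simp_all add: sets_metric_borel)
        show "range (\<lambda>_. mspace m) \<subseteq> {U. openin (mtopology_of m) U}"
          using openin_topspace[of "mtopology_of m"] by auto
        show "emeasure p (mspace m) \<noteq> \<infinity>"
          using P by (simp add: prob_space_def finite_measure.emeasure_finite)
      qed (use eqo in auto)
    next
      assume "p = q"
      have "\<epsilon> \<in> V p p" if "\<epsilon> > 0" for \<epsilon>
      proof -
        have "measure p A \<le> measure p (thickening m \<epsilon> A) + \<epsilon>" if "A \<in> sets (metric_borel m)" for A
        proof -
          have "A \<subseteq> thickening m \<epsilon> A"
          proof
            fix x assume "x \<in> A"
            moreover from this have xm: "x \<in> mspace m"
              using sets.sets_into_space[OF that] by auto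
            moreover have "mdist m x x < \<epsilon>"
              using Metric_space.mdist_zero[OF Metric_space_mspace_mdist xm] \<open>\<epsilon> > 0\<close> by (simp only:)
            ultimately show "x \<in> thickening m \<epsilon> A"
              by (auto simp: thickening_def intro!: bexI[of _ x])
          qed
          then have "measure p A \<le> measure p (thickening m \<epsilon> A)"
            using pq meas_thick by (intro mono) auto
          with \<open>\<epsilon> > 0\<close> show ?thesis by simp
        qed
        with that show ?thesis by (auto simp: V_def)
      qed
      then have "Inf (V p p) \<le> \<epsilon>" if "\<epsilon> > 0" for \<epsilon>
        using that by (intro cInf_lower bdd) auto
      then have "Inf (V p p) \<le> 0"
        by (rule field_le_epsilon[of _ 0, simplified])
      with nonneg[OF pq(1) pq(1)] d[OF pq] \<open>p = q\<close> show "prokhorov_dist m p q = 0" by simp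
    qed
    show "prokhorov_dist m p r \<le> prokhorov_dist m p q + prokhorov_dist m q r"
      if t: "p \<in> prob_measures m" "q \<in> prob_measures m" "r \<in> prob_measures m" for p q r
    proof -
      have half: "measure p A \<le> measure r (thickening m (\<epsilon> + \<delta>) A) + (\<epsilon> + \<delta>)"
        if "p \<in> prob_measures m" "q \<in> prob_measures m" "r \<in> prob_measures m"
          "\<epsilon> \<in> V p q" "\<delta> \<in> V q r" "A \<in> sets (metric_borel m)" for p q r \<epsilon> \<delta> A
      proof -
        have "measure p A \<le> measure q (thickening m \<epsilon> A) + \<epsilon>"
          using that by (auto simp: V_def)
        also have "measure q (thickening m \<epsilon> A)
            \<le> measure r (thickening m \<delta> (thickening m \<epsilon> A)) + \<delta>"
          using that openin_in_metric_borel[OF openin_thickening[of m \<epsilon> A]] by (auto simp: V_def)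
        also have "measure r (thickening m \<delta> (thickening m \<epsilon> A))
            \<le> measure r (thickening m (\<epsilon> + \<delta>) A)"
          using that by (intro mono thickening_thickening meas_thick)
        finally show ?thesis by simp
      qed
      have sum: "\<epsilon> + \<delta> \<in> V p r" if "\<epsilon> \<in> V p q" "\<delta> \<in> V q r" for \<epsilon> \<delta>
      proof -
        have "measure p A \<le> measure r (thickening m (\<epsilon> + \<delta>) A) + (\<epsilon> + \<delta>)"
          "measure r A \<le> measure p (thickening m (\<epsilon> + \<delta>) A) + (\<epsilon> + \<delta>)"
          if "A \<in> sets (metric_borel m)" for A
          using half[OF t \<open>\<epsilon> \<in> V p q\<close> \<open>\<delta> \<in> V q r\<close> that]
            half[OF t(3,2,1), of \<delta> \<epsilon> A] \<open>\<epsilon> \<in> V p q\<close> \<open>\<delta> \<in> V q r\<close> that V_commute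
          by (auto simp: add.commute)
        moreover have "0 < \<epsilon> + \<delta>" using that by (auto simp: V_def)
        ultimately show ?thesis by (auto simp: V_def)
      qed
      have "Inf (V p r) - \<delta> \<le> Inf (V p q)" if "\<delta> \<in> V q r" for \<delta>
        using one[OF t(1,2)] cInf_lower[OF sum[OF _ that] bdd] by (intro cInf_greatest) force+
      then have "Inf (V p r) - Inf (V p q) \<le> Inf (V q r)"
        using one[OF t(2,3)] by (intro cInf_greatest) force+
      then show ?thesis
        using d t by simp
    qed
  qed
qed

lemma mspace_prokhorov_metric [simp]: "mspace (prokhorov_metric m) = prob_measures m"
  and mdist_prokhorov_metric [simp]: "mdist (prokhorov_metric m) = prokhorov_dist m"
  unfolding prokhorov_metric_def
  using Metric_space_prokhorov[of m]
  by (simp_all add: Metric_space.mspace_metric Metric_space.mdist_metric)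

lemma rat_prob_vector_in_S_inf: "rat_prob_vector c \<in> S_inf"
proof -
  define ws where "ws = list_decode c"
  define N where "N = Suc (length ws)"
  have z: "rat_prob_vector c i = 0" if "i \<notin> {..<N}" for i
    using that by (auto simp: rat_prob_vector_def ws_def N_def Let_def)
  have nn: "0 \<le> rat_prob_vector c i" for i
    by (auto simp: rat_prob_vector_def Let_def)
  have sum: "(\<Sum>i<N. rat_prob_vector c i) = 1"
  proof (cases "sum_list ws = 0")
    case True
    then have "(\<Sum>i<N. rat_prob_vector c i) = (\<Sum>i<N. if i = 0 then 1 else 0)"
      unfolding rat_prob_vector_def ws_def by (intro sum.cong) auto
    then show ?thesis by (simp add: N_def)
  next
    case False
    then have "rat_prob_vector c i = (if i < length ws then real (ws ! i) / real (sum_list ws) else 0)" for i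
      unfolding rat_prob_vector_def ws_def[symmetric] Let_def by (simp only: if_False)
    then have "(\<Sum>i<N. rat_prob_vector c i) = (\<Sum>i<length ws. real (ws ! i) / real (sum_list ws))"
      by (simp add: N_def)
    also have "\<dots> = real (\<Sum>i<length ws. ws ! i) / real (sum_list ws)"
      by (simp add: sum_divide_distrib)
    also have "(\<Sum>i<length ws. ws ! i) = sum_list ws"
      by (simp add: sum_list_sum_nth atLeast0LessThan)
    finally show ?thesis using False by simp
  qed
  have "rat_prob_vector c i \<le> 1" for i
  proof (cases "i < N")
    case True
    then show ?thesis using member_le_sum[of i "{..<N}" "rat_prob_vector c"] nn sum by auto
  qed (use z in auto)
  moreover have "rat_prob_vector c sums 1"
    using sums_finite[of "{..<N}" "rat_prob_vector c"] z sum by auto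
  ultimately show ?thesis using nn by (auto simp: S_inf_def)
qed

lemma prob_space_vector_measure:
  assumes "\<theta> \<in> S_inf"
  shows "prob_space (vector_measure \<theta>)"
proof
  have "emeasure (vector_measure \<theta>) (space (vector_measure \<theta>)) = (\<Sum>i. ennreal (\<theta> i))"
    by (simp add: vector_measure_def emeasure_density nn_integral_count_space_nat)
  also have "\<dots> = ennreal (\<Sum>i. \<theta> i)"
    using assms by (intro suminf_ennreal2 S_inf_nonneg S_inf_summable)
  finally show "emeasure (vector_measure \<theta>) (space (vector_measure \<theta>)) = 1"
    using assms by (simp add: S_inf_suminf)
qed

lemma ideal_prob_presented:
  assumes "\<And>i. ideal X i \<in> mspace (met X)"
  shows "ideal (prob_presented X) c \<in> prob_measures (met X)"
proof -
  have "ideal X \<in> measurable (vector_measure (rat_prob_vector c)) (metric_borel (met X))"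
    using assms by (simp add: vector_measure_def)
  then show ?thesis
    using prob_space_vector_measure[OF rat_prob_vector_in_S_inf, of c]
    by (simp add: prob_presented_def prob_measures_def prob_space.prob_space_distr)
qed

end

theory Submission
  imports Defs
begin

text \<open>
  Approximate a prior by a rational mixture of finitely supported points, and give one atom \<open>\<eta>\<close> of it
  a support larger than that of every other atom. If \<open>\<theta>\<close> is approximated by a point whose support
  is contained in that of \<open>\<eta>\<close> but not in that of any other atom, then the data soon
  exhibit a symbol that only \<open>\<eta>\<close> can explain, and the posterior concentrates at \<open>\<eta>\<close>, wherever
  \<open>\<eta>\<close> lies. This persists in a small ball around the pair, of a radius computable from its code.
  Alternating \<open>\<eta>\<close> between the disjoint open sets \<open>\<theta> 0 > \<theta> 1\<close> and \<open>\<theta> 1 > \<theta> 0\<close> yields dense c.e.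
  open sets on whose intersection the posteriors of both sets exceed 1/2 infinitely often with
  positive probability, whereas \<open>\<theta>\<close> misses one of the two.
\<close>

section \<open>Closure properties of recursive functions\<close>

text \<open>
  On lists of the wrong length a recursive function has unspecified values, so recursiveness is
  taken up to agreement on lists of length \<open>k\<close>.
\<close>

definition recfn :: "nat \<Rightarrow> (nat list \<Rightarrow> nat) \<Rightarrow> bool" where
  "recfn k f \<longleftrightarrow> (\<exists>g. recursive_fn k g \<and> (\<forall>xs. length xs = k \<longrightarrow> f xs = g xs))"

lemma recfn_cong:
  assumes "recfn k f" "\<And>xs. length xs = k \<Longrightarrow> g xs = f xs"
  shows "recfn k g"
  using assms unfolding recfn_def by (metis (full_types))

lemma recfn_comp:
  assumes "recfn (length gs) f" "\<And>g. g \<in> set gs \<Longrightarrow> recfn k g"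
  shows "recfn k (\<lambda>xs. f (map (\<lambda>g. g xs) gs))"
proof -
  obtain f' where f': "recursive_fn (length gs) f'" "\<And>xs. length xs = length gs \<Longrightarrow> f xs = f' xs"
    using assms(1) unfolding recfn_def by blast
  have "\<exists>h. \<forall>g\<in>set gs. recursive_fn k (h g) \<and> (\<forall>xs. length xs = k \<longrightarrow> g xs = h g xs)"
    using assms(2) unfolding recfn_def by (intro bchoice) blast
  then obtain h where h: "\<And>g. g \<in> set gs \<Longrightarrow> recursive_fn k (h g)"
    "\<And>g xs. g \<in> set gs \<Longrightarrow> length xs = k \<Longrightarrow> g xs = h g xs"
    by blast
  have "recursive_fn k (\<lambda>xs. f' (map (\<lambda>g. g xs) (map h gs)))"
    using f'(1) h(1) by (intro recursive_fn.comp) auto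
  moreover have "f (map (\<lambda>g. g xs) gs) = f' (map (\<lambda>g. g xs) (map h gs))" if "length xs = k" for xs
  proof -
    have "map (\<lambda>g. g xs) gs = map (\<lambda>g. g xs) (map h gs)"
      using h(2) that by simp
    then show ?thesis
      using f'(2)[of "map (\<lambda>g. g xs) gs"] by (simp only: length_map)
  qed
  ultimately show ?thesis
    unfolding recfn_def by blast
qed

lemma recfn_nth: "i < k \<Longrightarrow> recfn k (\<lambda>xs. xs ! i)"
  unfolding recfn_def using recursive_fn.proj by blast

text \<open>The bodies of recursions, bounded sums and minimizations below reach their arguments
  through \<open>hd\<close> and \<open>tl\<close>; projections are provided in these shapes so that
  \<open>recfn_intros\<close> applies directly.\<close>

lemma recfn_hd: "recfn (Suc k) hd"
  using recfn_nth[of 0 "Suc k"] by (rule recfn_cong) (auto simp: length_Suc_conv)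

lemma recfn_tl_nth: "i < k \<Longrightarrow> recfn (Suc k) (\<lambda>xs. tl xs ! i)"
  using recfn_nth[of "Suc i" "Suc k"] by (rule recfn_cong) (auto simp: length_Suc_conv)

lemma recfn_hd_tl: "recfn (Suc (Suc k)) (\<lambda>xs. hd (tl xs))"
  using recfn_nth[of 1 "Suc (Suc k)"] by (rule recfn_cong) (auto simp: length_Suc_conv)

lemma recfn_tl_tl_nth: "i < k \<Longrightarrow> recfn (Suc (Suc k)) (\<lambda>xs. tl (tl xs) ! i)"
  using recfn_nth[of "Suc (Suc i)" "Suc (Suc k)"] by (rule recfn_cong) (auto simp: length_Suc_conv)

lemma recfn_comp1:
  assumes "recfn 1 (\<lambda>xs. F (xs ! 0))" "recfn k a"
  shows "recfn k (\<lambda>xs. F (a xs))"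
  using recfn_comp[of "[a]" "\<lambda>xs. F (xs ! 0)" k] assms by simp

lemma recfn_comp2:
  assumes "recfn 2 (\<lambda>xs. F (xs ! 0) (xs ! 1))" "recfn k a" "recfn k b"
  shows "recfn k (\<lambda>xs. F (a xs) (b xs))"
  using recfn_comp[of "[a, b]" "\<lambda>xs. F (xs ! 0) (xs ! 1)" k] assms by (auto simp: numeral_2_eq_2)

lemma recfn_Suc: "recfn k a \<Longrightarrow> recfn k (\<lambda>xs. Suc (a xs))"
  by (rule recfn_comp1) (use recursive_fn.succ in \<open>auto simp: recfn_def\<close>)

lemma recfn_const: "recfn k (\<lambda>xs. c)"
proof (induction c)
  case 0
  then show ?case using recursive_fn.zero by (auto simp: recfn_def)
qed (rule recfn_Suc)

lemma recfn_cons: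
  assumes "recfn (Suc k) f" "recfn k h"
  shows "recfn k (\<lambda>xs. f (h xs # xs))"
proof (rule recfn_cong)
  show "recfn k (\<lambda>xs. f (map (\<lambda>g. g xs) (h # map (\<lambda>i xs. xs ! i) [0..<k])))"
    using assms recfn_nth by (intro recfn_comp) auto
  show "f (h xs # xs) = f (map (\<lambda>g. g xs) (h # map (\<lambda>i xs. xs ! i) [0..<k]))"
    if "length xs = k" for xs
    using that map_nth[of xs] by (simp add: o_def)
qed

text \<open>\<open>prim\<close> recurses on the head of its argument list. Putting the bound
  \<open>h xs\<close> there by \<open>recfn_cons\<close> keeps all of \<open>xs\<close> as
  parameters and allows a computed recursion depth.\<close>

lemma recfn_rec:
  assumes "recfn k a" "recfn (Suc (Suc k)) (\<lambda>ys. g (hd ys) (hd (tl ys)) (tl (tl ys)))" "recfn k h"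
  shows "recfn k (\<lambda>xs. rec_nat (a xs) (\<lambda>n r. g n r xs) (h xs))"
proof -
  obtain a' where a': "recursive_fn k a'" "\<And>xs. length xs = k \<Longrightarrow> a xs = a' xs"
    using assms(1) unfolding recfn_def by blast
  obtain g' where g': "recursive_fn (Suc (Suc k)) g'"
    "\<And>ys. length ys = Suc (Suc k) \<Longrightarrow> g (hd ys) (hd (tl ys)) (tl (tl ys)) = g' ys"
    using assms(2) unfolding recfn_def by blast
  have "recfn (Suc k) (\<lambda>xs. rec_nat (a' (tl xs)) (\<lambda>n r. g' (n # r # tl xs)) (hd xs))"
    using recursive_fn.prim[OF a'(1) g'(1)] unfolding recfn_def by blast
  from recfn_cons[OF this assms(3)] show ?thesis
  proof (rule recfn_cong)
    fix xs :: "nat list" assume xs: "length xs = k"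
    have "g n r xs = g' (n # r # xs)" for n r
      using g'(2)[of "n # r # xs"] xs by simp
    then show "rec_nat (a xs) (\<lambda>n r. g n r xs) (h xs) =
      rec_nat (a' (tl (h xs # xs))) (\<lambda>n r. g' (n # r # tl (h xs # xs))) (hd (h xs # xs))"
      using a'(2)[OF xs] by simp
  qed
qed

lemma recfn_Least:
  assumes "recfn (Suc k) (\<lambda>ys. g (hd ys) (tl ys))" "\<And>xs. length xs = k \<Longrightarrow> \<exists>n. g n xs = 0"
  shows "recfn k (\<lambda>xs. LEAST n. g n xs = 0)"
proof -
  obtain g' where g': "recursive_fn (Suc k) g'"
    "\<And>ys. length ys = Suc k \<Longrightarrow> g (hd ys) (tl ys) = g' ys"
    using assms(1) unfolding recfn_def by blast
  have eq: "g' (n # xs) = g n xs" if "length xs = k" for n xs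
    using g'(2)[of "n # xs"] that by simp
  then have "recursive_fn k (\<lambda>xs. LEAST n. g' (n # xs) = 0)"
    using assms(2) by (intro recursive_fn.mu g') auto
  then show ?thesis
    unfolding recfn_def using eq by (intro exI conjI) auto
qed

named_theorems recfn_intros
declare recfn_nth [recfn_intros] recfn_hd [recfn_intros] recfn_tl_nth [recfn_intros]
  recfn_hd_tl [recfn_intros] recfn_tl_tl_nth [recfn_intros] recfn_Suc [recfn_intros]
  recfn_const [recfn_intros]

section \<open>Arithmetic operations\<close>

lemma recfn_add [recfn_intros]:
  assumes "recfn k a" "recfn k b"
  shows "recfn k (\<lambda>xs. a xs + b xs)"
proof (rule recfn_comp2[OF _ assms])
  have "recfn 2 (\<lambda>xs. rec_nat (xs ! 0) (\<lambda>n r. Suc r) (xs ! 1))"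
    by (intro recfn_rec recfn_intros) auto
  moreover have "rec_nat x (\<lambda>n r. Suc r) y = x + y" for x y
    by (induction y) auto
  ultimately show "recfn 2 (\<lambda>xs. xs ! 0 + xs ! 1)" by simp
qed

lemma recfn_mult [recfn_intros]:
  assumes "recfn k a" "recfn k b"
  shows "recfn k (\<lambda>xs. a xs * b xs)"
proof (rule recfn_comp2[OF _ assms])
  have "recfn 2 (\<lambda>xs. rec_nat 0 (\<lambda>n r. r + xs ! 0) (xs ! 1))"
    by (intro recfn_rec recfn_intros) auto
  moreover have "rec_nat 0 (\<lambda>n r. r + x) y = x * y" for x y :: nat
    by (induction y) auto
  ultimately show "recfn 2 (\<lambda>xs. xs ! 0 * xs ! 1)" by simp
qed

lemma recfn_power [recfn_intros]:
  assumes "recfn k a" "recfn k b"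
  shows "recfn k (\<lambda>xs. a xs ^ b xs)"
proof (rule recfn_comp2[OF _ assms])
  have "recfn 2 (\<lambda>xs. rec_nat 1 (\<lambda>n r. r * xs ! 0) (xs ! 1))"
    by (intro recfn_rec recfn_intros) auto
  moreover have "rec_nat 1 (\<lambda>n r. r * x) y = x ^ y" for x y :: nat
    by (induction y) auto
  ultimately show "recfn 2 (\<lambda>xs. xs ! 0 ^ xs ! 1)" by simp
qed

lemma recfn_diff [recfn_intros]:
  assumes "recfn k a" "recfn k b"
  shows "recfn k (\<lambda>xs. a xs - b xs)"
proof (rule recfn_comp2[OF _ assms])
  have "recfn 1 (\<lambda>xs. rec_nat 0 (\<lambda>n r. n) (xs ! 0))"
    by (intro recfn_rec recfn_intros) auto
  moreover have "rec_nat 0 (\<lambda>n r. n) x = x - 1" for x :: nat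
    by (induction x) auto
  ultimately have pred: "recfn 1 (\<lambda>xs. xs ! 0 - 1)" by simp
  have "recfn 2 (\<lambda>xs. rec_nat (xs ! 0) (\<lambda>n r. r - 1) (xs ! 1))"
    by (intro recfn_rec recfn_comp1[OF pred] recfn_intros) auto
  moreover have "rec_nat x (\<lambda>n r. r - 1) y = x - y" for x y :: nat
    by (induction y) auto
  ultimately show "recfn 2 (\<lambda>xs. xs ! 0 - xs ! 1)" by simp
qed

lemma recfn_mod_2 [recfn_intros]:
  assumes "recfn k a"
  shows "recfn k (\<lambda>xs. a xs mod 2)"
proof -
  \<comment> \<open>Iterating r \<mapsto> 1 - r from 0 toggles between 0 and 1.\<close>
  have "recfn k (\<lambda>xs. rec_nat 0 (\<lambda>n r. 1 - r) (a xs))"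
    using assms by (intro recfn_rec recfn_intros) auto
  moreover have "rec_nat 0 (\<lambda>n r. 1 - r) x = x mod 2" for x :: nat
    by (induction x) (auto simp: mod_Suc)
  ultimately show ?thesis by simp
qed

lemma recfn_sum [recfn_intros]:
  assumes "recfn (Suc k) (\<lambda>ys. g (hd ys) (tl ys))" "recfn k h"
  shows "recfn k (\<lambda>xs. \<Sum>l<h xs. g l xs)"
proof -
  \<comment> \<open>The recursion step sees index, accumulator and parameters; projections remove
    the accumulator before \<open>g\<close> is applied.\<close>
  have "recfn (Suc (Suc k)) (\<lambda>ys. (\<lambda>zs. g (hd zs) (tl zs))
     (map (\<lambda>g. g ys) (hd # map (\<lambda>i ys. tl (tl ys) ! i) [0..<k])))"
    using assms(1) by (intro recfn_comp) (auto intro: recfn_intros)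
  then have "recfn (Suc (Suc k)) (\<lambda>ys. g (hd ys) (tl (tl ys)))"
  proof (rule recfn_cong)
    fix ys :: "nat list" assume "length ys = Suc (Suc k)"
    then show "g (hd ys) (tl (tl ys)) =
        (\<lambda>zs. g (hd zs) (tl zs)) (map (\<lambda>g. g ys) (hd # map (\<lambda>i ys. tl (tl ys) ! i) [0..<k]))"
      using map_nth[of "tl (tl ys)"] by (simp add: o_def)
  qed
  then have "recfn k (\<lambda>xs. rec_nat 0 (\<lambda>n r. r + g n xs) (h xs))"
    using assms(2) by (intro recfn_rec recfn_intros)
  moreover have "rec_nat 0 (\<lambda>n r. r + g n xs) y = (\<Sum>l<y. g l xs)" for xs y
    by (induction y) auto
  ultimately show ?thesis by simp
qed

section \<open>Decoding of pairs and lists\<close>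

lemma recfn_triangle [recfn_intros]:
  assumes "recfn k a"
  shows "recfn k (\<lambda>xs. triangle (a xs))"
proof -
  have "triangle n = (\<Sum>l<n. Suc l)" for n
    by (induction n) auto
  moreover have "recfn k (\<lambda>xs. \<Sum>l<a xs. Suc l)"
    using assms by (intro recfn_intros)
  ultimately show ?thesis by simp
qed

lemma triangle_mono: "m \<le> n \<Longrightarrow> triangle m \<le> triangle n"
  by (rule lift_Suc_mono_le) auto

text \<open>The Cantor code is \<open>triangle (a + b) + a\<close> with a \<le> a + b, so it is at
  least \<open>triangle (a + b)\<close> and below \<open>triangle (Suc (a + b))\<close>. The
  truncated difference vanishes exactly when the code is below the upper end, hence the search finds
  the diagonal.\<close>

lemma Least_triangle_prod_encode:
  "(LEAST s. Suc (prod_encode (a, b)) - triangle (Suc s) = 0) = a + b"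
proof (rule Least_equality)
  show "Suc (prod_encode (a, b)) - triangle (Suc (a + b)) = 0"
    by (simp add: prod_encode_def)
  show "a + b \<le> s" if "Suc (prod_encode (a, b)) - triangle (Suc s) = 0" for s
  proof (rule ccontr)
    assume "\<not> a + b \<le> s"
    then have "triangle (Suc s) \<le> triangle (a + b)"
      by (intro triangle_mono) simp
    with that show False by (simp add: prod_encode_def)
  qed
qed

lemma recfn_prod_decode:
  shows recfn_fst_prod_decode [recfn_intros]: "recfn k a \<Longrightarrow> recfn k (\<lambda>xs. fst (prod_decode (a xs)))"
    and recfn_snd_prod_decode [recfn_intros]: "recfn k a \<Longrightarrow> recfn k (\<lambda>xs. snd (prod_decode (a xs)))"
proof -
  define s where "s c = (LEAST s. Suc c - triangle (Suc s) = 0)" for c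
  have s: "s c = fst (prod_decode c) + snd (prod_decode c)" for c
    using Least_triangle_prod_encode[of "fst (prod_decode c)" "snd (prod_decode c)"]
    by (simp add: s_def)
  have c: "c = triangle (fst (prod_decode c) + snd (prod_decode c)) + fst (prod_decode c)" for c
    using prod_decode_inverse[of c] by (simp add: prod_encode_def case_prod_unfold)
  have "recfn 1 (\<lambda>xs. LEAST t. Suc (xs ! 0) - triangle (Suc t) = 0)"
  proof (rule recfn_Least)
    show "recfn (Suc 1) (\<lambda>ys. Suc (tl ys ! 0) - triangle (Suc (hd ys)))"
      by (intro recfn_intros) auto
    show "\<exists>n. Suc (xs ! 0) - triangle (Suc n) = 0" for xs :: "nat list"
      by (rule exI[of _ "xs ! 0"]) simp
  qed
  then have sr: "recfn 1 (\<lambda>xs. s (xs ! 0))" by (simp add: s_def)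
  have 1: "c - triangle (s c) = fst (prod_decode c)" for c
    using c[of c] unfolding s by linarith
  have 2: "s c - (c - triangle (s c)) = snd (prod_decode c)" for c
    by (simp only: 1) (simp add: s)
  show "recfn k (\<lambda>xs. fst (prod_decode (a xs)))" if "recfn k a"
    unfolding 1[symmetric] using that by (intro recfn_intros recfn_comp1[OF sr])
  show "recfn k (\<lambda>xs. snd (prod_decode (a xs)))" if "recfn k a"
    unfolding 2[symmetric] using that by (intro recfn_intros recfn_comp1[OF sr])
qed

text \<open>Reading absent entries as 0 makes lookup total and matches
  \<open>rat_prob_vector\<close> whenever the total weight is nonzero.\<close>

definition code_nth :: "nat \<Rightarrow> nat \<Rightarrow> nat" where
  "code_nth c k = (if k < length (list_decode c) then list_decode c ! k else 0)"

lemma recfn_code_nth [recfn_intros]: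
  assumes "recfn k a" "recfn k b"
  shows "recfn k (\<lambda>xs. code_nth (a xs) (b xs))"
proof (rule recfn_comp2[OF _ assms])
  \<comment> \<open>\<open>d c k\<close> codes the list without its first \<open>k\<close> entries:
    a nonempty list is coded by the successor of the pair of its head and the code of its tail. At
    code 0 the predecessor is 0 and decodes to (0, 0), so the empty list gets itself as tail and 0
    as head.\<close>
  define d where "d c k = rec_nat c (\<lambda>_ r. snd (prod_decode (r - 1))) k" for c k
  have pd0: "prod_decode 0 = (0, 0)"
    using prod_encode_inverse[of "(0, 0)"] by (simp add: prod_encode_def)
  have tl: "list_decode (snd (prod_decode (c - 1))) = tl (list_decode c)" for c
    by (cases c) (simp_all add: pd0 split: prod.split)
  have d: "list_decode (d c k) = drop k (list_decode c)" for c k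
    by (induction k) (simp_all add: d_def tl[simplified] drop_Suc tl_drop)
  have "fst (prod_decode (c - 1)) = (if list_decode c = [] then 0 else hd (list_decode c))" for c
    by (cases c) (simp_all add: pd0 split: prod.split)
  then have "fst (prod_decode (d c k - 1)) = code_nth c k" for c k
    by (simp add: d code_nth_def hd_drop_conv_nth)
  moreover have "recfn 2 (\<lambda>xs. fst (prod_decode (d (xs ! 0) (xs ! 1) - 1)))"
    unfolding d_def by (intro recfn_intros recfn_rec) auto
  ultimately show "recfn 2 (\<lambda>xs. code_nth (xs ! 0) (xs ! 1))" by simp
qed

section \<open>Codes of dominated pairs\<close>

lemma code_nth_list_encode:
  "code_nth (list_encode ws) k = (if k < length ws then ws ! k else 0)"
  by (simp add: code_nth_def)

text \<open>A pair code is at least the sum of its components, and the successor in the code of a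
  nonempty list pays for its length. This is why a code alone yields lower bounds on normalized
  weights.\<close>

lemma sum_list_length_list_decode_le: "sum_list (list_decode c) \<le> c \<and> length (list_decode c) \<le> c"
proof (induction c rule: less_induct)
  case (less c)
  show ?case
  proof (cases c)
    case (Suc m)
    obtain x y where xy: "prod_decode m = (x, y)" by force
    then have m: "m = prod_encode (x, y)" by (metis prod_decode_inverse)
    have t: "n \<le> triangle n" for n by (induction n) auto
    have "x + y \<le> m" unfolding m prod_encode_def using t[of "x + y"] by simp
    then show ?thesis
      using less.IH[of y] Suc xy by simp
  qed simp
qed

lemma sum_list_list_decode_le: "sum_list (list_decode c) \<le> c"
  and length_list_decode_le: "length (list_decode c) \<le> c"
  using sum_list_length_list_decode_le by blast+

text \<open>This bounds the quantifiers over \<open>l\<close> and \<open>k'\<close> in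
  \<open>dominant\<close>, so that they become finite sums.\<close>

lemma code_nth_pos_imp_less: "0 < code_nth c k \<Longrightarrow> k < c"
  using length_list_decode_le[of c] by (auto simp: code_nth_def split: if_splits)

text \<open>
  A radius \<open>r\<close> with \<open>2 * r < (1 / L) ^ (N + 1)\<close> for the sample size \<open>N = 2 * L\<close>: the right-hand side bounds
  from below the contribution to the evidence of an atom with all relevant weights at least \<open>2 / L\<close>,
  while \<open>2 * r\<close> bounds that of everything else.
\<close>

definition radius_code :: "nat \<Rightarrow> nat" where
  "radius_code L = triangle (2 * L ^ (2 * L + 1))"

text \<open>\<open>triangle m\<close> is the code of the pair (0, m), which
  \<open>rat_radius\<close> sends to 1 / (m + 1).\<close>

lemma rat_radius_radius_code:
  "rat_radius (radius_code L) = 1 / (2 * real L ^ (2 * L + 1) + 1)"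
proof -
  have "prod_decode (radius_code L) = (0, 2 * L ^ (2 * L + 1))"
    using prod_encode_inverse[of "(0, 2 * L ^ (2 * L + 1))"] by (simp add: prod_encode_def radius_code_def)
  then show ?thesis by (simp add: rat_radius_def)
qed

text \<open>
  In the mixture coded by \<open>pc\<close>, the atom \<open>k\<close> explains all symbols in the support of the parameter
  coded by \<open>tc\<close>, and it is the only atom that explains the symbol \<open>M\<close>. Requiring \<open>M > 0\<close> takes care
  of the atoms whose code has total weight 0: these denote the point mass at 0.
\<close>

definition dominant :: "nat \<Rightarrow> nat \<Rightarrow> nat \<Rightarrow> nat \<Rightarrow> nat \<Rightarrow> bool" where
  "dominant b pc tc k M \<longleftrightarrow>
     0 < code_nth pc k \<and> 0 < code_nth tc M \<and> 0 < M \<and>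
     (\<forall>l. 0 < code_nth tc l \<longrightarrow> 0 < code_nth k l) \<and>
     (\<forall>k'. k' \<noteq> k \<and> 0 < code_nth pc k' \<longrightarrow> code_nth k' M = 0) \<and>
     code_nth k (1 - b) < code_nth k b"

text \<open>
  All positive weights occurring in the objects coded by \<open>i\<close> are at least \<open>1 / i\<close>, which is why the
  radius can be computed from \<open>i\<close>; its dependence on the stage \<open>xs ! 0\<close> makes the sample size grow.
\<close>

definition ball_relation :: "nat list \<Rightarrow> bool" where
  "ball_relation xs \<longleftrightarrow>
     (\<exists>k M. dominant (xs ! 0 mod 2) (fst (prod_decode (xs ! 1))) (snd (prod_decode (xs ! 1))) k M) \<and>
     xs ! 2 = radius_code (2 * (xs ! 0 + xs ! 1 + 2))"

text \<open>An arithmetic form of \<open>dominant\<close>, one summand per conjunct: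
  \<open>1 - x\<close> vanishes for positive x, a product vanishes when an implication holds, and
  the symmetric truncated difference vanishes only for equal indices.\<close>

definition dominance_defect :: "nat \<Rightarrow> nat \<Rightarrow> nat \<Rightarrow> nat \<Rightarrow> nat \<Rightarrow> nat" where
  "dominance_defect b pc tc k M =
     (1 - code_nth pc k) + (1 - code_nth tc M) + (1 - M) +
     (\<Sum>l<tc. code_nth tc l * (1 - code_nth k l)) +
     (\<Sum>k'<pc. ((k' - k) + (k - k')) * (code_nth pc k' * code_nth k' M)) +
     (Suc (code_nth k (1 - b)) - code_nth k b)"

lemma dominance_defect_eq_0_iff: "dominance_defect b pc tc k M = 0 \<longleftrightarrow> dominant b pc tc k M"
proof -
  have "(\<Sum>l<tc. code_nth tc l * (1 - code_nth k l)) = 0 \<longleftrightarrow>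
      (\<forall>l. 0 < code_nth tc l \<longrightarrow> 0 < code_nth k l)"
    using code_nth_pos_imp_less[of tc] by (simp add: Suc_le_eq) (metis lessThan_iff not_gr0)
  moreover have "(\<Sum>k'<pc. ((k' - k) + (k - k')) * (code_nth pc k' * code_nth k' M)) = 0 \<longleftrightarrow>
      (\<forall>k'. k' \<noteq> k \<and> 0 < code_nth pc k' \<longrightarrow> code_nth k' M = 0)"
  proof -
    have "(k' - k) + (k - k') = 0 \<longleftrightarrow> k' = k" for k' by auto
    then show ?thesis
      using code_nth_pos_imp_less[of pc] unfolding sum_eq_0_iff[OF finite_lessThan] mult_eq_0_iff
      by (metis lessThan_iff neq0_conv)
  qed
  ultimately show ?thesis
    unfolding dominance_defect_def dominant_def add_eq_0_iff_both_eq_0 by auto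
qed

lemma ce_ball_relation: "ce_relation 3 ball_relation"
proof -
  \<comment> \<open>The extra first argument is the search variable and codes the pair
    (\<open>k\<close>, \<open>M\<close>); the relation's own arguments are shifted by one. The last
    two summands force the radius to be the prescribed one.\<close>
  define f where "f xs = dominance_defect (xs ! 1 mod 2) (fst (prod_decode (xs ! 2)))
      (snd (prod_decode (xs ! 2))) (fst (prod_decode (xs ! 0))) (snd (prod_decode (xs ! 0)))
     + ((xs ! 3 - radius_code (2 * (xs ! 1 + xs ! 2 + 2))) +
        (radius_code (2 * (xs ! 1 + xs ! 2 + 2)) - xs ! 3))" for xs
  have "recfn 4 f"
    unfolding f_def dominance_defect_def radius_code_def by (intro recfn_intros) auto
  then obtain g where g: "recursive_fn 4 g" "\<And>xs. length xs = 4 \<Longrightarrow> f xs = g xs"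
    unfolding recfn_def by blast
  have "ball_relation xs \<longleftrightarrow> (\<exists>m. g (m # xs) = 0)" if "length xs = 3" for xs
  proof -
    have "g (m # xs) = f (m # xs)" for m
      using g(2)[of "m # xs"] that by simp
    moreover have "f (m # xs) = 0 \<longleftrightarrow>
      dominant (xs ! 0 mod 2) (fst (prod_decode (xs ! 1))) (snd (prod_decode (xs ! 1)))
        (fst (prod_decode m)) (snd (prod_decode m)) \<and>
      xs ! 2 = radius_code (2 * (xs ! 0 + xs ! 1 + 2))" for m
      unfolding f_def add_eq_0_iff_both_eq_0 dominance_defect_eq_0_iff by auto
    ultimately show ?thesis
      unfolding ball_relation_def by (metis prod_encode_inverse fst_conv snd_conv)
  qed
  with g(1) show ?thesis
    unfolding ce_relation_def by (intro exI[of _ g]) simp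
qed

section \<open>Lower bounds for rational weights\<close>

lemma rat_prob_vector_eq:
  assumes "0 < code_nth c l"
  shows "rat_prob_vector c k = real (code_nth c k) / real (sum_list (list_decode c))"
    "0 < sum_list (list_decode c)"
proof -
  have "l < length (list_decode c)" "0 < list_decode c ! l"
    using assms by (auto simp: code_nth_def split: if_splits)
  then show *: "0 < sum_list (list_decode c)"
    using elem_le_sum_list order_less_le_trans by blast
  then show "rat_prob_vector c k = real (code_nth c k) / real (sum_list (list_decode c))"
    unfolding rat_prob_vector_def code_nth_def Let_def by (simp del: sum_list_eq_0_iff)
qed

lemma rat_prob_vector_ge:
  assumes "0 < code_nth c k" "c \<le> Z"
  shows "1 / real Z \<le> rat_prob_vector c k"
proof -
  have "real (sum_list (list_decode c)) \<le> real Z"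
    using sum_list_list_decode_le[of c] assms(2) by linarith
  then show ?thesis
    using rat_prob_vector_eq[OF assms(1)] assms(1) by (auto intro: frac_le)
qed

text \<open>Distinct integer weights differ by at least 1 before normalization. The gap will keep a
  whole ball around the atom on the same side of the comparison.\<close>

lemma rat_prob_vector_gap:
  assumes "code_nth c k < code_nth c l" "c \<le> Z"
  shows "rat_prob_vector c k + 1 / real Z \<le> rat_prob_vector c l"
proof -
  have pos: "0 < code_nth c l" using assms(1) by simp
  have "real (sum_list (list_decode c)) \<le> real Z"
    using sum_list_list_decode_le[of c] assms(2) by linarith
  then have "1 / real Z \<le> 1 / real (sum_list (list_decode c))"
    using rat_prob_vector_eq(2)[OF pos] by (intro divide_left_mono) auto
  moreover have "(real (code_nth c k) + 1) / real (sum_list (list_decode c))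
      \<le> real (code_nth c l) / real (sum_list (list_decode c))"
    using assms(1) by (intro divide_right_mono) auto
  ultimately show ?thesis
    unfolding rat_prob_vector_eq(1)[OF pos] by (simp add: add_divide_distrib)
qed

lemma rat_prob_vector_eq_0: "0 < M \<Longrightarrow> code_nth c M = 0 \<Longrightarrow> rat_prob_vector c M = 0"
  by (auto simp: rat_prob_vector_def code_nth_def Let_def split: if_splits)

lemma rat_prob_vector_pos_imp: "0 < code_nth c l \<Longrightarrow> 0 < rat_prob_vector c k \<Longrightarrow> 0 < code_nth c k"
  using rat_prob_vector_eq(1)[of c l k] by (auto simp: zero_less_divide_iff)

section \<open>Density of dominated pairs\<close>

lemma S_inf_summable_indicator:
  assumes "\<theta> \<in> S_inf"
  shows "summable (\<lambda>k. \<theta> k * indicator S k :: real)"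
  by (rule summable_comparison_test'[OF S_inf_summable[OF assms], of 0])
     (use S_inf_nonneg[OF assms] in \<open>auto simp: indicator_def\<close>)

lemma measure_vector_measure:
  assumes "\<theta> \<in> S_inf"
  shows "measure (vector_measure \<theta>) S = (\<Sum>k. \<theta> k * indicator S k)"
proof -
  have "emeasure (vector_measure \<theta>) S = (\<Sum>k. ennreal (\<theta> k * indicator S k))"
    by (auto simp: vector_measure_def emeasure_density nn_integral_count_space_nat indicator_def
        intro!: suminf_cong)
  also have "\<dots> = ennreal (\<Sum>k. \<theta> k * indicator S k)"
    using assms by (intro suminf_ennreal2 S_inf_summable_indicator) (simp add: S_inf_nonneg)
  finally show ?thesis
    using assms S_inf_summable_indicator
    by (simp add: measure_def suminf_nonneg S_inf_nonneg)
qed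

lemma measure_vector_measure_singleton:
  assumes "\<theta> \<in> S_inf"
  shows "measure (vector_measure \<theta>) {k} = \<theta> k"
  unfolding measure_vector_measure[OF assms] by (subst suminf_finite[of "{k}"]) auto

lemma measure_vector_measure_le_l1_dist:
  assumes "\<theta> \<in> S_inf" "\<eta> \<in> S_inf"
  shows "measure (vector_measure \<theta>) S \<le> measure (vector_measure \<eta>) S + l1_dist \<theta> \<eta>"
proof -
  have "(\<Sum>k. \<theta> k * indicator S k) \<le> (\<Sum>k. \<eta> k * indicator S k + \<bar>\<theta> k - \<eta> k\<bar>)"
    using assms by (intro suminf_le summable_add S_inf_summable_indicator S_inf_diff_summable)
      (auto simp: indicator_def)
  also have "\<dots> = (\<Sum>k. \<eta> k * indicator S k) + l1_dist \<theta> \<eta>"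
    using assms by (simp add: suminf_add S_inf_summable_indicator S_inf_diff_summable l1_dist_eq_suminf)
  finally show ?thesis
    using assms by (simp add: measure_vector_measure)
qed

lemma sets_vector_measure [simp, measurable_cong]: "sets (vector_measure \<theta>) = UNIV"
  and space_vector_measure [simp]: "space (vector_measure \<theta>) = UNIV"
  by (simp_all add: vector_measure_def)

definition mixture :: "(nat \<Rightarrow> real) \<Rightarrow> (nat \<Rightarrow> real) measure" where
  "mixture u = distr (vector_measure u) (metric_borel S_inf_metric) rat_prob_vector"

lemma ideal_prob_presented_S_inf: "ideal (prob_presented S_inf_space) c = mixture (rat_prob_vector c)"
  by (simp add: prob_presented_def S_inf_space_def mixture_def)

lemma measurable_rat_prob_vector:
  "rat_prob_vector \<in> measurable (vector_measure u) (metric_borel S_inf_metric)"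
  by (simp add: measurable_def rat_prob_vector_in_S_inf)

lemma mixture_in_prob_measures: "u \<in> S_inf \<Longrightarrow> mixture u \<in> prob_measures S_inf_metric"
  using prob_space.prob_space_distr[OF prob_space_vector_measure measurable_rat_prob_vector]
  by (simp add: mixture_def prob_measures_def)

lemma measure_mixture:
  assumes "A \<in> sets (metric_borel S_inf_metric)"
  shows "measure (mixture u) A = measure (vector_measure u) {k. rat_prob_vector k \<in> A}"
  using measure_distr[OF measurable_rat_prob_vector assms] by (simp add: mixture_def vimage_def)

section \<open>Estimates for the Prokhorov distance\<close>

lemma prob_measuresD:
  assumes "p \<in> prob_measures m"
  shows "prob_space p" "sets p = sets (metric_borel m)" "space p = mspace m"
  using assms sets_eq_imp_space_eq[of p "metric_borel m"] by (auto simp: prob_measures_def)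

lemma thickening_in_sets: "thickening m \<epsilon> A \<in> sets (metric_borel m)"
  by (rule openin_in_metric_borel[OF openin_thickening])

lemma prokhorov_dist_le:
  assumes "p \<in> prob_measures m" "q \<in> prob_measures m" "0 < \<epsilon>"
    and "\<And>A. A \<in> sets (metric_borel m) \<Longrightarrow> measure p A \<le> measure q (thickening m \<epsilon> A) + \<epsilon>"
    and "\<And>A. A \<in> sets (metric_borel m) \<Longrightarrow> measure q A \<le> measure p (thickening m \<epsilon> A) + \<epsilon>"
  shows "prokhorov_dist m p q \<le> \<epsilon>"
  unfolding prokhorov_dist_def using assms
  by (auto intro!: cInf_lower bdd_belowI[of _ 0])

text \<open>Some admissible \<epsilon> lies below \<open>r\<close>, and enlarging it to
  \<open>r\<close> only increases the right-hand side.\<close>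

lemma prokhorov_dist_lessD:
  assumes pq: "p \<in> prob_measures m" "q \<in> prob_measures m" and r: "prokhorov_dist m p q < r"
    and A: "A \<in> sets (metric_borel m)"
  shows "measure p A \<le> measure q (thickening m r A) + r"
proof -
  define V where "V = {\<epsilon>. 0 < \<epsilon> \<and> (\<forall>A\<in>sets (metric_borel m).
             measure p A \<le> measure q (thickening m \<epsilon> A) + \<epsilon> \<and>
             measure q A \<le> measure p (thickening m \<epsilon> A) + \<epsilon>)}"
  note P = prob_measuresD[OF pq(1)] and Q = prob_measuresD[OF pq(2)]
  have "1 \<in> V"
    unfolding V_def
    by (auto intro: order_trans[OF prob_space.prob_le_1[OF P(1)]] order_trans[OF prob_space.prob_le_1[OF Q(1)]])
  moreover have "Inf V < r"
    using r pq by (simp add: prokhorov_dist_def V_def)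
  ultimately obtain \<epsilon> where \<epsilon>: "\<epsilon> \<in> V" "\<epsilon> < r"
    using cInf_lessD[of V r] by blast
  interpret q: prob_space q by (rule Q(1))
  have "measure p A \<le> measure q (thickening m \<epsilon> A) + \<epsilon>"
    using \<epsilon>(1) A by (auto simp: V_def)
  also have "measure q (thickening m \<epsilon> A) \<le> measure q (thickening m r A)"
    using \<epsilon>(2) by (intro q.finite_measure_mono thickening_mono) (auto simp: Q(2) thickening_in_sets)
  finally show ?thesis using \<epsilon>(2) by simp
qed

lemma subset_thickening:
  assumes "A \<subseteq> mspace m" "0 < \<epsilon>"
  shows "A \<subseteq> thickening m \<epsilon> A"
  using assms Metric_space.centre_in_mball_iff[OF Metric_space_mspace_mdist[of m]]
  by (fastforce simp: thickening_def mball_of_def)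

text \<open>Both mixtures use the same atoms, so their values on any set differ by at most the
  \<open>l1_dist\<close> of the weights.\<close>

lemma prokhorov_dist_mixture_le:
  assumes "u \<in> S_inf" "v \<in> S_inf" "l1_dist u v < \<epsilon>"
  shows "prokhorov_dist S_inf_metric (mixture u) (mixture v) \<le> \<epsilon>"
proof -
  have "0 < \<epsilon>"
    using Metric_space.nonneg[OF Metric_space_S_inf, of u v] assms(3) by linarith
  have *: "measure (mixture u) A \<le> measure (mixture v) (thickening S_inf_metric \<epsilon> A) + \<epsilon>"
    if A: "A \<in> sets (metric_borel S_inf_metric)" and uv: "u \<in> S_inf" "v \<in> S_inf" "l1_dist u v < \<epsilon>" for A u v
  proof -
    interpret v: prob_space "mixture v"
      using prob_measuresD(1)[OF mixture_in_prob_measures[OF uv(2)]] .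
    have "measure (mixture u) A \<le> measure (mixture v) A + l1_dist u v"
      unfolding measure_mixture[OF A] by (rule measure_vector_measure_le_l1_dist[OF uv(1,2)])
    also have "measure (mixture v) A \<le> measure (mixture v) (thickening S_inf_metric \<epsilon> A)"
      using \<open>0 < \<epsilon>\<close> sets.sets_into_space[OF A]
      by (intro v.finite_measure_mono subset_thickening)
         (auto simp: mixture_def thickening_in_sets)
    finally show ?thesis using uv(3) by simp
  qed
  show ?thesis
    using assms \<open>0 < \<epsilon>\<close> Metric_space.commute[OF Metric_space_S_inf, of u v]
    by (intro prokhorov_dist_le mixture_in_prob_measures *) auto
qed

text \<open>The first \<open>N0\<close> weights are rounded down and all remaining mass goes to a
  single index \<open>N\<close>, which may be any large number. For a parameter this puts a chosen
  symbol into the support; for the weights of a mixture it charges a chosen new atom.\<close>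

lemma rational_approx:
  assumes \<theta>: "\<theta> \<in> S_inf" and \<epsilon>: "0 < \<epsilon>"
  shows "\<exists>N0. \<forall>N\<ge>N0. \<exists>ws. length ws = Suc N \<and> 0 < ws ! N \<and> (\<forall>k. N0 \<le> k \<longrightarrow> k < N \<longrightarrow> ws ! k = 0) \<and>
           l1_dist \<theta> (rat_prob_vector (list_encode ws)) < \<epsilon>"
proof -
  have "\<forall>\<^sub>F N in sequentially. (\<Sum>i<N. \<theta> i) > 1 - \<epsilon> / 4"
    using \<theta> \<epsilon> by (intro order_tendstoD(1)[of _ 1]) (auto simp: S_inf_def sums_def)
  then obtain N0 where N0: "(\<Sum>i<N0. \<theta> i) > 1 - \<epsilon> / 4"
    by (auto simp: eventually_sequentially)
  \<comment> \<open>Each of the first \<open>N0\<close> coordinates will be off by at most 2 /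
    \<open>D\<close>, which then sums to at most \<epsilon> / 4.\<close>
  obtain D0 :: nat where D0: "real D0 > 8 * real N0 / \<epsilon>"
    using reals_Archimedean2 by blast
  \<comment> \<open>Rounding uses \<open>D0\<close>, normalization uses \<open>D0\<close> + 1, so a
    positive weight is always left for index \<open>N\<close>.\<close>
  define D where "D = Suc D0"
  define f where "f i = nat \<lfloor>real D0 * \<theta> i\<rfloor>" for i
  have f: "real (f i) \<le> real D0 * \<theta> i" "real D0 * \<theta> i - 1 < real (f i)" for i
    using S_inf_nonneg[OF \<theta>, of i] by (auto simp: f_def)
  have "(\<Sum>i<N0. \<theta> i) \<le> 1"
    using sum_le_suminf[OF S_inf_summable[OF \<theta>], of "{..<N0}"] S_inf_nonneg[OF \<theta>]
    by (simp add: S_inf_suminf[OF \<theta>])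
  then have "real D0 * (\<Sum>i<N0. \<theta> i) \<le> real D0"
    by (simp add: mult_left_le)
  moreover have "real (\<Sum>i<N0. f i) \<le> real D0 * (\<Sum>i<N0. \<theta> i)"
    using f(1) by (simp add: sum_distrib_left sum_mono)
  ultimately have sf: "(\<Sum>i<N0. f i) \<le> D0" by linarith
  have "\<exists>ws. length ws = Suc N \<and> 0 < ws ! N \<and> (\<forall>k. N0 \<le> k \<longrightarrow> k < N \<longrightarrow> ws ! k = 0) \<and>
           l1_dist \<theta> (rat_prob_vector (list_encode ws)) < \<epsilon>" if "N0 \<le> N" for N
  proof -
    define g where "g k = (if k < N0 then f k else if k = N then D - (\<Sum>i<N0. f i) else 0)" for k
    define ws where "ws = map g [0..<Suc N]"
    have "sum_list ws = (\<Sum>k<Suc N. g k)"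
      unfolding ws_def by (simp only: interv_sum_list_conv_sum_set_nat atLeast0LessThan set_upt)
    also have "\<dots> = (\<Sum>k<N. g k) + (D - (\<Sum>i<N0. f i))"
      using that by (simp add: g_def)
    also have "(\<Sum>k<N. g k) = (\<Sum>k<N0. f k)"
      using that by (intro sum.mono_neutral_cong_right) (auto simp: g_def)
    finally have sum: "sum_list ws = D"
      using sf by (simp add: D_def)
    have rpv: "rat_prob_vector (list_encode ws) i = real (f i) / real D" if "i < N0" for i
      using that \<open>N0 \<le> N\<close> unfolding rat_prob_vector_def list_encode_inverse Let_def sum
      by (simp add: D_def ws_def g_def nth_append)
    have "\<bar>\<theta> i - rat_prob_vector (list_encode ws) i\<bar> \<le> 2 / real D" if "i < N0" for i
    proof -
      have "0 \<le> \<theta> i" "\<theta> i \<le> 1" using \<theta> by (auto simp: S_inf_def)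
      then have "\<bar>real D * \<theta> i - real (f i)\<bar> \<le> 2"
        using f[of i] unfolding D_def of_nat_Suc distrib_right by linarith
      moreover have "\<theta> i - rat_prob_vector (list_encode ws) i = (real D * \<theta> i - real (f i)) / real D"
        unfolding rpv[OF that] by (simp add: D_def diff_divide_distrib)
      ultimately show ?thesis
        by (simp add: divide_right_mono)
    qed
    then have "(\<Sum>i<N0. \<bar>\<theta> i - rat_prob_vector (list_encode ws) i\<bar>) \<le> (\<Sum>i<N0. 2 / real D)"
      by (intro sum_mono) auto
    also have "\<dots> = 2 * real N0 / real D" by simp
    also have "\<dots> \<le> \<epsilon> / 4"
      using D0 \<epsilon> by (simp add: D_def field_simps)
    finally have "(\<Sum>i<N0. \<bar>\<theta> i - rat_prob_vector (list_encode ws) i\<bar>) \<le> \<epsilon> / 4" .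
    \<comment> \<open>\<open>l1_dist_le_initial\<close> doubles the initial error \<open>s\<close>
      and the tail 1 - \<open>t\<close>; the strict bound on the tail gives a strict total.\<close>
    moreover have "a < \<epsilon>" if "a \<le> 2 * s + 2 * (1 - t)" "s \<le> \<epsilon> / 4" "1 - \<epsilon> / 4 < t" for a s t
      using that by argo
    ultimately have "l1_dist \<theta> (rat_prob_vector (list_encode ws)) < \<epsilon>"
      using l1_dist_le_initial[OF \<theta> rat_prob_vector_in_S_inf] N0 by blast
    then show ?thesis
      using sf that by (intro exI[of _ ws]) (auto simp: ws_def g_def D_def nth_append)
  qed
  then show ?thesis by blast
qed

lemma rat_prob_vector_dense:
  assumes "\<theta> \<in> S_inf" "0 < \<epsilon>"
  shows "\<exists>c. l1_dist \<theta> (rat_prob_vector c) < \<epsilon>"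
  using rational_approx[OF assms] by blast

text \<open>Cut the space into disjoint pieces \<open>B k\<close> within \<epsilon> of the
  \<open>k\<close>-th ideal point and move the mass of each piece to that point. A piece meeting
  \<open>A\<close> has its point in the thickening of \<open>A\<close>, and a piece whose point is
  in \<open>A\<close> lies in that thickening.\<close>

lemma prokhorov_dist_mixture_dense:
  assumes p: "p \<in> prob_measures S_inf_metric" and \<epsilon>: "0 < \<epsilon>"
  shows "\<exists>u\<in>S_inf. prokhorov_dist S_inf_metric p (mixture u) \<le> \<epsilon>"
proof -
  note P = prob_measuresD[OF p]
  interpret p: prob_space p by (rule P(1))
  interpret S: Metric_space S_inf l1_dist by (rule Metric_space_S_inf)
  have mb: "mball_of S_inf_metric = S.mball" by (simp add: mball_of_def)
  define B where "B = disjointed (\<lambda>k. S.mball (rat_prob_vector k) \<epsilon>)"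
  define u where "u k = measure p (B k)" for k
  have "range (\<lambda>k. S.mball (rat_prob_vector k) \<epsilon>) \<subseteq> sets p"
    unfolding P(2) by (auto intro!: openin_in_metric_borel simp: mtopology_of_def)
  then have Bs: "range B \<subseteq> sets p"
    unfolding B_def by (rule sets.range_disjointed_sets)
  have "(\<Union>k. S.mball (rat_prob_vector k) \<epsilon>) = S_inf"
    using rat_prob_vector_dense[OF _ \<epsilon>] by (auto simp: rat_prob_vector_in_S_inf S.commute)
  then have BU: "(\<Union>k. B k) = S_inf"
    by (simp add: B_def UN_disjointed_eq)
  have Bd: "disjoint_family B"
    unfolding B_def by (rule disjoint_family_disjointed)
  have Bb: "l1_dist (rat_prob_vector k) x < \<epsilon>" if "x \<in> B k" for x k
    using that disjointed_subset[of "\<lambda>k. S.mball (rat_prob_vector k) \<epsilon>" k] by (auto simp: B_def)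
  have sums: "(\<lambda>k. measure p (C \<inter> B k)) sums measure p C" if "C \<in> sets p" for C
  proof -
    have "(\<lambda>k. measure p (C \<inter> B k)) sums measure p (\<Union>k. C \<inter> B k)"
      using that Bs Bd by (intro p.finite_measure_UNION) (auto simp: disjoint_family_on_def)
    moreover have "(\<Union>k. C \<inter> B k) = C"
      using BU sets.sets_into_space[OF that] P(3) by auto
    ultimately show ?thesis by simp
  qed
  have "S_inf \<inter> B k = B k" for k using BU by auto
  then have "u sums 1"
    using sums[OF sets.top] p.prob_space unfolding P(3) by (simp add: u_def[abs_def])
  then have u: "u \<in> S_inf"
    by (auto simp: S_inf_def u_def p.prob_le_1)
  have "prokhorov_dist S_inf_metric p (mixture u) \<le> \<epsilon>"
  proof (rule prokhorov_dist_le[OF p mixture_in_prob_measures[OF u] \<epsilon>])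
    fix A assume A: "A \<in> sets (metric_borel S_inf_metric)"
    let ?T = "thickening S_inf_metric \<epsilon> A"
    have AS: "A \<subseteq> S_inf" using sets.sets_into_space[OF A] by simp
    have "measure p A = (\<Sum>k. measure p (A \<inter> B k))"
      using sums[of A] A by (simp add: P(2) sums_iff)
    also have "\<dots> \<le> (\<Sum>k. u k * indicator {k. rat_prob_vector k \<in> ?T} k)"
    proof (rule suminf_le)
      show "summable (\<lambda>k. measure p (A \<inter> B k))"
        using sums[of A] A by (simp add: P(2) sums_iff)
      show "summable (\<lambda>k. u k * indicator {k. rat_prob_vector k \<in> ?T} k)"
        by (rule S_inf_summable_indicator[OF u])
      show "measure p (A \<inter> B k) \<le> u k * indicator {k. rat_prob_vector k \<in> ?T} k" for k
      proof (cases "A \<inter> B k = {}")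
        case False
        then obtain a where a: "a \<in> A" "a \<in> B k" by auto
        then have "rat_prob_vector k \<in> ?T"
          using AS Bb[OF a(2)]
          by (auto simp: thickening_def mb rat_prob_vector_in_S_inf S.commute)
        then show ?thesis
          using Bs by (simp add: u_def) (intro p.finite_measure_mono, auto)
      qed (simp add: u_def)
    qed
    also have "\<dots> = measure (mixture u) ?T"
      by (simp add: measure_mixture[OF thickening_in_sets] measure_vector_measure[OF u])
    finally show "measure p A \<le> measure (mixture u) ?T + \<epsilon>" using \<epsilon> by simp
    have "measure (mixture u) A = (\<Sum>k. u k * indicator {k. rat_prob_vector k \<in> A} k)"
      by (simp add: measure_mixture[OF A] measure_vector_measure[OF u])
    also have "\<dots> \<le> (\<Sum>k. measure p (?T \<inter> B k))"
    proof (rule suminf_le)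
      show "summable (\<lambda>k. measure p (?T \<inter> B k))"
        using sums[of ?T] by (simp add: P(2) sums_iff thickening_in_sets)
      show "summable (\<lambda>k. u k * indicator {k. rat_prob_vector k \<in> A} k)"
        by (rule S_inf_summable_indicator[OF u])
      show "u k * indicator {k. rat_prob_vector k \<in> A} k \<le> measure p (?T \<inter> B k)" for k
      proof (cases "rat_prob_vector k \<in> A")
        case True
        have "B k \<subseteq> ?T"
          using True Bb[of _ k] BU AS by (fastforce simp: thickening_def mb)
        then have "?T \<inter> B k = B k" by auto
        then show ?thesis using True by (simp add: u_def)
      qed simp
    qed
    also have "\<dots> = measure p ?T"
      using sums[of ?T] by (simp add: P(2) sums_iff thickening_in_sets)
    finally show "measure (mixture u) A \<le> measure p ?T + \<epsilon>" using \<epsilon> by simp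
  qed
  with u show ?thesis by blast
qed

text \<open>The order of choices matters. \<open>K\<close> bounds the codes of the old atoms;
  \<open>M\<close> > \<open>K\<close> lies outside their supports, since a code exceeds every index
  of its support; \<open>k\<close> then codes a new atom supported on all indices up to
  \<open>M\<close>. The leftover mass goes to \<open>k\<close>, at a small cost wherever that atom
  lies.\<close>

lemma dominant_dense:
  assumes p: "p \<in> prob_measures S_inf_metric" and \<theta>: "\<theta> \<in> S_inf" and \<epsilon>: "0 < \<epsilon>" and b: "b < 2"
  shows "\<exists>pc tc k M. dominant b pc tc k M \<and>
    prokhorov_dist S_inf_metric p (mixture (rat_prob_vector pc)) < \<epsilon> \<and>
    l1_dist \<theta> (rat_prob_vector tc) < \<epsilon>"
proof -
  obtain u where u: "u \<in> S_inf" "prokhorov_dist S_inf_metric p (mixture u) \<le> \<epsilon> / 3"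
    using prokhorov_dist_mixture_dense[OF p, of "\<epsilon> / 3"] \<epsilon> by auto
  obtain K where K: "\<And>N. N \<ge> K \<Longrightarrow> \<exists>ws. length ws = Suc N \<and> 0 < ws ! N \<and>
      (\<forall>k. K \<le> k \<longrightarrow> k < N \<longrightarrow> ws ! k = 0) \<and> l1_dist u (rat_prob_vector (list_encode ws)) < \<epsilon> / 3"
    using rational_approx[OF u(1), of "\<epsilon> / 3"] \<epsilon> by auto
  obtain M0 where M0: "\<And>N. N \<ge> M0 \<Longrightarrow> \<exists>ws. length ws = Suc N \<and> 0 < ws ! N \<and>
      l1_dist \<theta> (rat_prob_vector (list_encode ws)) < \<epsilon>"
    using rational_approx[OF \<theta> \<epsilon>] by metis
  define M where "M = max M0 (Suc K)"
  obtain ts where ts: "length ts = Suc M" "0 < ts ! M" "l1_dist \<theta> (rat_prob_vector (list_encode ts)) < \<epsilon>"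
    using M0[of M] by (auto simp: M_def)
  \<comment> \<open>Weight 2 at \<open>b\<close> makes coordinate \<open>b\<close> beat
    \<open>1 - b\<close>, and the ones cover the support of \<open>ts\<close>. Since
    \<open>M\<close> > 0, the index \<open>b\<close> is within range.\<close>
  define es where "es = map (\<lambda>l. if l = b then 2 else 1 :: nat) [0..<Suc M]"
  define k where "k = list_encode es"
  have es: "length es = Suc M" by (simp add: es_def)
  have nth_k: "code_nth k l = (if l \<le> M then if l = b then 2 else 1 else 0)" for l
    by (auto simp: k_def code_nth_list_encode es_def nth_append)
  \<comment> \<open>A code is at least the length of its list, so \<open>k\<close> may serve as the
    index that receives the leftover mass.\<close>
  have "K \<le> k"
    using length_list_decode_le[of k] by (simp add: k_def es M_def)
  then obtain ws where ws: "length ws = Suc k" "0 < ws ! k"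
      "\<And>k'. K \<le> k' \<Longrightarrow> k' < k \<Longrightarrow> ws ! k' = 0"
      "l1_dist u (rat_prob_vector (list_encode ws)) < \<epsilon> / 3"
    using K by metis
  have "code_nth k' M = 0" if "k' \<noteq> k" "0 < code_nth (list_encode ws) k'" for k'
  proof -
    have "k' < K"
      using that ws(1) ws(3)[of k'] by (force simp: code_nth_list_encode split: if_splits)
    then show ?thesis
      using code_nth_pos_imp_less[of k' M] by (auto simp: M_def)
  qed
  moreover have "1 - b \<noteq> b" by (cases b) auto
  ultimately have "dominant b (list_encode ws) (list_encode ts) k M"
    using ts ws b unfolding dominant_def nth_k
    by (auto simp: code_nth_list_encode M_def less_Suc_eq_le split: if_splits)
  moreover have "prokhorov_dist S_inf_metric p (mixture (rat_prob_vector (list_encode ws))) < \<epsilon>"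
  proof -
    have "prokhorov_dist S_inf_metric p (mixture (rat_prob_vector (list_encode ws)))
      \<le> prokhorov_dist S_inf_metric p (mixture u)
        + prokhorov_dist S_inf_metric (mixture u) (mixture (rat_prob_vector (list_encode ws)))"
      using p u(1) mixture_in_prob_measures rat_prob_vector_in_S_inf
      by (intro Metric_space.triangle[OF Metric_space_prokhorov]) auto
    also have "\<dots> \<le> \<epsilon> / 3 + \<epsilon> / 3"
      using u ws(4) rat_prob_vector_in_S_inf by (intro add_mono prokhorov_dist_mixture_le) auto
    finally show ?thesis using \<epsilon> by simp
  qed
  ultimately show ?thesis using ts(3) by blast
qed

section \<open>Concentration of the posterior near dominated pairs\<close>

lemma likelihood_bounds:
  assumes "\<theta> \<in> S_inf"
  shows "0 \<le> likelihood \<theta> \<sigma>" "likelihood \<theta> \<sigma> \<le> 1"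
  using assms by (auto simp: likelihood_def S_inf_def intro!: prod_nonneg prod_le_1)

lemma likelihood_le_coord:
  assumes "\<theta> \<in> S_inf" "M \<in> set \<sigma>"
  shows "likelihood \<theta> \<sigma> \<le> \<theta> M"
proof -
  obtain i where i: "i < length \<sigma>" "\<sigma> ! i = M"
    using assms(2) by (auto simp: in_set_conv_nth)
  have "likelihood \<theta> \<sigma> = \<theta> (\<sigma> ! i) * (\<Prod>i\<in>{..<length \<sigma>} - {i}. \<theta> (\<sigma> ! i))"
    unfolding likelihood_def using i(1) by (intro prod.remove) auto
  also have "\<dots> \<le> \<theta> (\<sigma> ! i) * 1"
    using assms(1) by (intro mult_left_mono prod_le_1) (auto simp: S_inf_def)
  finally show ?thesis using i(2) by simp
qed

lemma likelihood_ge_power: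
  assumes "\<And>l. l \<in> set \<sigma> \<Longrightarrow> a \<le> \<theta> l" "0 \<le> a"
  shows "a ^ length \<sigma> \<le> likelihood \<theta> \<sigma>"
proof -
  have "(\<Prod>i<length \<sigma>. a) \<le> (\<Prod>i<length \<sigma>. \<theta> (\<sigma> ! i))"
    using assms by (intro prod_mono) auto
  then show ?thesis by (simp add: likelihood_def)
qed

lemma borel_measurable_metric_borel_S_inf:
  assumes "f \<in> borel_measurable borel"
  shows "f \<in> borel_measurable (metric_borel S_inf_metric)"
  using measurable_restrict_space1[OF assms, of S_inf]
  by (simp cong: measurable_cong_sets add: measurable_cong_sets[OF sets_metric_borel_S_inf refl])

lemma measurable_likelihood: "(\<lambda>\<theta>. likelihood \<theta> \<sigma>) \<in> borel_measurable (metric_borel S_inf_metric)"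
proof (rule borel_measurable_metric_borel_S_inf)
  have "continuous_on UNIV (\<lambda>\<theta>. likelihood \<theta> \<sigma>)"
    unfolding likelihood_def by (intro continuous_intros continuous_on_product_coordinates)
  then show "(\<lambda>\<theta>. likelihood \<theta> \<sigma>) \<in> borel_measurable borel"
    by (rule borel_measurable_continuous_onI)
qed

text \<open>\<open>U\<close> contributes at least the part over \<open>T\<close>, more than 2 *
  \<open>r\<close>. The complement contributes at most \<open>r\<close> from outside
  \<open>F\<close>, where the likelihood is at most 1, and at most \<open>r\<close> from inside
  \<open>F\<close>.\<close>

lemma posterior_gt_half:
  assumes p: "p \<in> prob_measures S_inf_metric"
    and U: "U \<in> sets (metric_borel S_inf_metric)"
    and T: "T \<in> sets (metric_borel S_inf_metric)" "T \<subseteq> U"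
    and F: "F \<in> sets (metric_borel S_inf_metric)" "1 - r \<le> measure p F"
    and lower: "\<And>\<theta>. \<theta> \<in> T \<Longrightarrow> c \<le> likelihood \<theta> \<sigma>"
    and upper: "\<And>\<theta>. \<theta> \<in> F \<Longrightarrow> \<theta> \<notin> U \<Longrightarrow> likelihood \<theta> \<sigma> \<le> r"
    and r: "0 \<le> r" and gap: "2 * r < c * measure p T"
  shows "1 / 2 < posterior p U \<sigma>"
proof -
  note P = prob_measuresD[OF p]
  interpret p: prob_space p by (rule P(1))
  have Um: "U \<in> sets p" "T \<in> sets p" "F \<in> sets p" using U T F by (simp_all add: P(2))
  then have Uc: "space p - U \<in> sets p" "space p - F \<in> sets p" by auto
  have Lm: "(\<lambda>\<theta>. likelihood \<theta> \<sigma>) \<in> borel_measurable p"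
    using measurable_likelihood by (simp add: measurable_cong_sets[OF P(2) refl])
  have sp: "space p = S_inf" using P(3) by simp
  have int: "integrable p (\<lambda>\<theta>. likelihood \<theta> \<sigma> * indicator A \<theta>)" if "A \<in> sets p" for A
    using Lm that likelihood_bounds
    by (intro p.integrable_const_bound[where B = 1] AE_I2 borel_measurable_times borel_measurable_indicator)
       (auto simp: sp split: split_indicator)
  have int1: "integrable p (\<lambda>\<theta>. likelihood \<theta> \<sigma>)"
    using Lm likelihood_bounds by (intro p.integrable_const_bound[where B = 1]) (auto simp: sp)
  have ind: "integrable p (indicator A :: _ \<Rightarrow> real)" if "A \<in> sets p" for A
    using that by (simp add: p.emeasure_finite less_top[symmetric])
  define num where "num = (LINT \<theta>|p. likelihood \<theta> \<sigma> * indicator U \<theta>)"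
  define rest where "rest = (LINT \<theta>|p. likelihood \<theta> \<sigma> * indicator (space p - U) \<theta>)"
  have "(LINT \<theta>|p. likelihood \<theta> \<sigma>) =
      (LINT \<theta>|p. likelihood \<theta> \<sigma> * indicator U \<theta> + likelihood \<theta> \<sigma> * indicator (space p - U) \<theta>)"
    by (intro Bochner_Integration.integral_cong) (auto simp: indicator_def)
  also have "\<dots> = num + rest"
    unfolding num_def rest_def using Um Uc by (intro Bochner_Integration.integral_add int) auto
  finally have den: "(LINT \<theta>|p. likelihood \<theta> \<sigma>) = num + rest" .
  have "c * measure p T = (LINT \<theta>|p. c * indicator T \<theta>)"
    using Um by simp
  also have "\<dots> \<le> num"
    unfolding num_def using Um T(2) lower likelihood_bounds
    by (intro integral_mono int integrable_mult_right ind) (auto simp: sp split: split_indicator)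
  finally have num: "2 * r < num" using gap by simp
  have "rest \<le> (LINT \<theta>|p. indicator (space p - F) \<theta> + r)"
    unfolding rest_def using Um Uc upper likelihood_bounds r
    by (intro integral_mono int Bochner_Integration.integrable_add ind)
       (auto intro: ind simp: sp add_increasing2 split: split_indicator)
  also have "\<dots> = (LINT \<theta>|p. indicator (space p - F) \<theta>) + (LINT \<theta>|p. r)"
    using Uc by (intro Bochner_Integration.integral_add ind) auto
  also have "\<dots> = 1 - measure p F + r"
    using Um by (simp add: p.prob_compl p.prob_space)
  finally have rest: "rest \<le> 2 * r" using F(2) by simp
  have "0 \<le> rest"
    unfolding rest_def using likelihood_bounds
    by (intro integral_nonneg_AE AE_I2) (auto simp: sp)
  have "posterior p U \<sigma> = num / (num + rest)"
    using num r \<open>0 \<le> rest\<close>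
    by (simp add: posterior_def den set_lebesgue_integral_def num_def mult.commute)
  moreover have "1 / 2 < num / (num + rest)"
    using num rest r \<open>0 \<le> rest\<close> by (simp add: field_simps)
  ultimately show ?thesis by simp
qed

section \<open>The law of the data\<close>

lemma prob_space_P_measure: "\<theta> \<in> S_inf \<Longrightarrow> prob_space (P_measure \<theta>)"
  unfolding P_measure_def by (intro prob_space_PiM prob_space_vector_measure)

lemma space_P_measure [simp]: "space (P_measure \<theta>) = UNIV"
  by (simp add: P_measure_def space_PiM)

lemma cylinder_eq_prod_emb:
  "{x. \<forall>i<N. x i \<in> S} = prod_emb UNIV (\<lambda>_. vector_measure \<theta>) {..<N} (Pi\<^sub>E {..<N} (\<lambda>_. S))"
  by (auto simp: prod_emb_def PiE_iff)

lemma cylinder_in_sets_P_measure: "{x. \<forall>i<N. x i \<in> S} \<in> sets (P_measure \<theta>)"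
  unfolding cylinder_eq_prod_emb[of N S \<theta>] P_measure_def by (rule sets_PiM_I) auto

lemma measure_P_measure_cylinder:
  assumes "\<theta> \<in> S_inf"
  shows "measure (P_measure \<theta>) {x. \<forall>i<N. x i \<in> S} = measure (vector_measure \<theta>) S ^ N"
proof -
  interpret product_prob_space "\<lambda>_. vector_measure \<theta>" "UNIV :: nat set"
    using prob_space_vector_measure[OF assms]
    by (simp add: product_prob_space_def product_sigma_finite_def product_prob_space_axioms_def
        prob_space_imp_sigma_finite)
  show ?thesis
    unfolding cylinder_eq_prod_emb[of N S \<theta>] P_measure_def
    using measure_PiM_emb[of "{..<N}" "\<lambda>_. S"] by simp
qed

definition target :: "nat \<Rightarrow> (nat \<Rightarrow> real) set" where
  "target b = {\<theta> \<in> S_inf. \<theta> (1 - b) < \<theta> b}"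

lemma openin_target: "openin (top_of_set S_inf) (target b)"
proof -
  have "open {\<theta> :: nat \<Rightarrow> real. \<theta> (1 - b) < \<theta> b}"
    by (intro open_Collect_less continuous_on_product_coordinates)
  moreover have "target b = S_inf \<inter> {\<theta>. \<theta> (1 - b) < \<theta> b}" by (auto simp: target_def)
  ultimately show ?thesis by (simp add: openin_open_Int)
qed

text \<open>The event is \<open>A - C\<close>: the first \<open>N\<close> symbols stay in the
  support coded by \<open>tc\<close>, and \<open>M\<close> is among them. \<open>A\<close> has
  probability at least 3/4 by closeness to \<open>tc\<close>, and missing \<open>M\<close> in
  \<open>N\<close> draws has probability below 1/4. On the event, parameters near any atom other
  than \<open>k\<close> have likelihood at most \<open>r\<close>.\<close>

lemma dominant_imp_posterior:
  assumes dom: "dominant b pc tc k M"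
    and Z: "pc \<le> Z" "tc \<le> Z" "2 \<le> Z"
    and L: "L = 2 * real Z" "N = 4 * Z" and r: "r = 1 / (2 * L ^ (N + 1) + 1)"
    and p: "p \<in> prob_measures S_inf_metric"
      "prokhorov_dist S_inf_metric (mixture (rat_prob_vector pc)) p < r"
    and \<theta>: "\<theta> \<in> S_inf" "l1_dist (rat_prob_vector tc) \<theta> < r"
  shows "\<exists>E\<in>sets (P_measure \<theta>). 1 / 2 < measure (P_measure \<theta>) E \<and>
    (\<forall>x\<in>E. 1 / 2 < posterior p (target b) (map x [0..<N]))"
proof -
  let ?q = rat_prob_vector
  interpret S: Metric_space S_inf l1_dist by (rule Metric_space_S_inf)
  interpret p: prob_space p using prob_measuresD(1)[OF p(1)] .
  interpret Pm: prob_space "P_measure \<theta>" using prob_space_P_measure[OF \<theta>(1)] .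
  have mb: "mball_of S_inf_metric = S.mball" by (simp add: mball_of_def)
  have dom': "0 < code_nth pc k" "0 < code_nth tc M" "0 < M"
      "\<And>l. 0 < code_nth tc l \<Longrightarrow> 0 < code_nth k l"
      "\<And>k'. k' \<noteq> k \<Longrightarrow> 0 < code_nth pc k' \<Longrightarrow> code_nth k' M = 0"
      "code_nth k (1 - b) < code_nth k b"
    using dom by (auto simp: dominant_def)
  \<comment> \<open>An atom of positive weight has index below \<open>pc\<close>, so
    \<open>Z\<close> also controls the weights of the atom itself.\<close>
  have kZ: "k \<le> Z" using code_nth_pos_imp_less[OF dom'(1)] Z(1) by simp
  have L4: "4 \<le> L" using L(1) Z(3) by simp
  \<comment> \<open>Exact weights are at least 2 / \<open>L\<close>; a move by \<open>r\<close>
    \<le> 1 / \<open>L\<close> leaves at least 1 / \<open>L\<close>.\<close>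
  have Z2: "1 / real Z = 2 / L" using L(1) by simp
  \<comment> \<open>Reciprocal of the evidence bound: likelihood (1 /
    \<open>L\<close>)^\<open>N\<close> times prior mass 1 / \<open>L\<close>.\<close>
  define P where "P = L ^ (N + 1)"
  have P: "4 * L \<le> P" "L \<le> P" "0 < P"
  proof -
    have "L ^ (1 + 1) \<le> P"
      unfolding P_def using L4 Z(3) L(2) by (intro power_increasing) auto
    moreover have "4 * L \<le> L * L"
      using L4 by (intro mult_right_mono) auto
    ultimately show "4 * L \<le> P" by simp
    with L4 show "L \<le> P" "0 < P" by linarith+
  qed
  have r_P: "r = 1 / (2 * P + 1)" by (simp add: r P_def)
  have "0 < r" using P(3) by (simp add: r_P)
  have "r \<le> 1 / L"
    unfolding r_P using P(2) L4 by (intro frac_le) linarith+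
  have r_small: "2 * r < 1 / P"
    unfolding r_P using P(3) by (simp add: field_simps)
  have Nr: "real N * r \<le> 1 / 4"
  proof -
    have "real N * 4 \<le> 2 * P + 1"
      using L P(1) by simp
    then show ?thesis
      unfolding r_P using P(3) by (simp add: field_simps)
  qed
  have close: "\<bar>s l - t l\<bar> < r" if "s \<in> S_inf" "t \<in> S_inf" "l1_dist s t < r" for s t l
    using coord_le_l1_dist[OF that(1,2), of l] that(3) by linarith

  \<comment> \<open>\<open>T\<close> lies around the dominating atom, \<open>F\<close> around all
    atoms of positive weight; the Prokhorov bound transfers their masses to \<open>p\<close> up to
    \<open>r\<close>.\<close>
  define T where "T = thickening S_inf_metric r {?q k}"
  define F where "F = thickening S_inf_metric r (?q ` {k'. 0 < ?q pc k'})"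
  have T_iff: "t \<in> T \<longleftrightarrow> t \<in> S_inf \<and> l1_dist (?q k) t < r" for t
    by (auto simp: T_def thickening_def mb rat_prob_vector_in_S_inf)
  have T_target: "T \<subseteq> target b"
  proof
    fix t assume "t \<in> T"
    then have t: "t \<in> S_inf" "l1_dist (?q k) t < r" by (auto simp: T_iff)
    show "t \<in> target b"
      using rat_prob_vector_gap[OF dom'(6) kZ] close[OF rat_prob_vector_in_S_inf t, of b]
        close[OF rat_prob_vector_in_S_inf t, of "1 - b"] \<open>r \<le> 1 / L\<close> t(1) unfolding Z2
      by (simp add: target_def)
  qed
  have sets_p: "A \<in> sets (metric_borel S_inf_metric)" if "finite A" "A \<subseteq> S_inf" for A
  proof -
    have "closedin (mtopology_of S_inf_metric) A"
      using that closedin_Hausdorff_finite[OF S.Hausdorff_space_mtopology] by (simp add: mtopology_of_def)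
    then have "S_inf - (S_inf - A) \<in> sets (metric_borel S_inf_metric)"
      using sets.compl_sets[OF openin_in_metric_borel[of S_inf_metric "S_inf - A"]]
      by (simp add: closedin_def mtopology_of_def)
    then show ?thesis using that(2) by (simp add: double_diff)
  qed
  have pT: "1 / L \<le> measure p T"
  proof -
    have "2 / L \<le> ?q pc k"
      using rat_prob_vector_ge[OF dom'(1) Z(1)] Z2 by simp
    also have "\<dots> = measure (vector_measure (?q pc)) {k}"
      by (simp add: measure_vector_measure_singleton rat_prob_vector_in_S_inf)
    also have "\<dots> \<le> measure (mixture (?q pc)) {?q k}"
      unfolding measure_mixture[OF sets_p[of "{?q k}", simplified], OF rat_prob_vector_in_S_inf]
      by (intro finite_measure.finite_measure_mono prob_space.finite_measure
          prob_space_vector_measure rat_prob_vector_in_S_inf) auto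
    also have "\<dots> \<le> measure p T + r"
      unfolding T_def using p
      by (intro prokhorov_dist_lessD mixture_in_prob_measures sets_p) (auto simp: rat_prob_vector_in_S_inf)
    finally show ?thesis using \<open>r \<le> 1 / L\<close> by simp
  qed
  have pF: "1 - r \<le> measure p F"
  proof -
    let ?K = "{k'. 0 < ?q pc k'}"
    have "finite ?K"
      by (rule finite_subset[of _ "{..<pc}"])
         (use rat_prob_vector_pos_imp[OF dom'(1)] code_nth_pos_imp_less in auto)
    have "1 = measure (vector_measure (?q pc)) UNIV"
      using prob_space.prob_space[OF prob_space_vector_measure[OF rat_prob_vector_in_S_inf, of pc]] by simp
    also have "\<dots> \<le> measure (vector_measure (?q pc)) {k'. ?q k' \<in> ?q ` ?K}"
      unfolding measure_vector_measure[OF rat_prob_vector_in_S_inf]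
      using S_inf_nonneg[OF rat_prob_vector_in_S_inf, of pc]
      by (intro suminf_le S_inf_summable_indicator rat_prob_vector_in_S_inf)
         (auto simp: indicator_def less_le)
    also have "\<dots> = measure (mixture (?q pc)) (?q ` ?K)"
      using \<open>finite ?K\<close> by (subst measure_mixture[OF sets_p]) (auto simp: rat_prob_vector_in_S_inf)
    also have "\<dots> \<le> measure p F + r"
      unfolding F_def using p \<open>finite ?K\<close>
      by (intro prokhorov_dist_lessD mixture_in_prob_measures sets_p) (auto simp: rat_prob_vector_in_S_inf)
    finally show ?thesis by simp
  qed

  define G where "G = {l. 0 < code_nth tc l}"
  define A where "A = {x. \<forall>i<N. x i \<in> G}"
  define C where "C = {x. \<forall>i<N. x i \<in> - {M}}"
  have AC: "A \<in> sets (P_measure \<theta>)" "C \<in> sets (P_measure \<theta>)"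
    unfolding A_def C_def by (rule cylinder_in_sets_P_measure)+
  have post: "1 / 2 < posterior p (target b) (map x [0..<N])" if "x \<in> A - C" for x
  proof (rule posterior_gt_half[OF p(1) _ _ T_target, where F = F and c = "(1 / L) ^ N" and r = r])
    let ?\<sigma> = "map x [0..<N]"
    have \<sigma>: "set ?\<sigma> \<subseteq> G" "M \<in> set ?\<sigma>"
      using that by (auto simp: A_def C_def)
    show "target b \<in> sets (metric_borel S_inf_metric)"
      using openin_target by (intro openin_in_metric_borel) (simp add: mtopology_of_S_inf_metric)
    show "T \<in> sets (metric_borel S_inf_metric)" "F \<in> sets (metric_borel S_inf_metric)"
      by (simp_all add: T_def F_def thickening_in_sets)
    show "1 - r \<le> measure p F" "0 \<le> r" using pF \<open>0 < r\<close> by simp_all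
    show "(1 / L) ^ N \<le> likelihood t ?\<sigma>" if "t \<in> T" for t
    proof -
      have "1 / L \<le> t l" if "l \<in> G" for l
        using rat_prob_vector_ge[OF dom'(4) kZ, of l] that \<open>r \<le> 1 / L\<close>
          close[of "?q k" t l] \<open>t \<in> T\<close> unfolding Z2
        by (auto simp: G_def T_iff rat_prob_vector_in_S_inf)
      then show ?thesis
        using likelihood_ge_power[of ?\<sigma> "1 / L" t] \<sigma> L4 by auto
    qed
    show "likelihood t ?\<sigma> \<le> r" if t: "t \<in> F" "t \<notin> target b" for t
    proof -
      obtain k' where k': "0 < ?q pc k'" "t \<in> S_inf" "l1_dist (?q k') t < r"
        using t(1) by (auto simp: F_def thickening_def mb)
      \<comment> \<open>A parameter within \<open>r\<close> of the atom \<open>k\<close> would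
        belong to \<open>T\<close>, hence to \<open>target b\<close>.\<close>
      have "k' \<noteq> k"
        using k' t(2) T_target by (auto simp: T_iff)
      then have "?q k' M = 0"
        using dom'(3,5) rat_prob_vector_pos_imp[OF dom'(1) k'(1)] by (intro rat_prob_vector_eq_0) auto
      then have "t M \<le> r"
        using close[OF rat_prob_vector_in_S_inf k'(2,3), of M] by simp
      then show ?thesis
        using likelihood_le_coord[OF k'(2) \<sigma>(2)] by simp
    qed
    have "(1 / L) ^ N * (1 / L) \<le> (1 / L) ^ N * measure p T"
      using L4 pT by (intro mult_left_mono) auto
    then show "2 * r < (1 / L) ^ N * measure p T"
      using r_small by (simp add: P_def power_divide mult.commute)
  qed
  have "1 / 2 < measure (P_measure \<theta>) (A - C)"
  proof -
    let ?g = "measure (vector_measure \<theta>) G"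
    have "1 = measure (vector_measure (?q tc)) G"
    proof -
      have "?q tc l * indicator G l = ?q tc l" for l
        using rat_prob_vector_eq(1)[OF dom'(2), of l] by (auto simp: G_def indicator_def)
      then show ?thesis
        by (simp only: measure_vector_measure rat_prob_vector_in_S_inf S_inf_suminf)
    qed
    then have "1 - r \<le> ?g"
      using measure_vector_measure_le_l1_dist[OF rat_prob_vector_in_S_inf \<theta>(1), of tc G] \<theta>(2) by simp
    have "1 / L \<le> 1" using L4 by simp
    with \<open>r \<le> 1 / L\<close> have "r \<le> 1" by linarith
    \<comment> \<open>Bernoulli's inequality bounds the probability that all \<open>N\<close>
      symbols stay in \<open>G\<close>.\<close>
    have "1 - real N * r \<le> (1 - r) ^ N"
      using Bernoulli_inequality[of "- r" N] \<open>r \<le> 1\<close> by simp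
    also have "\<dots> \<le> ?g ^ N"
      using \<open>1 - r \<le> ?g\<close> \<open>r \<le> 1\<close> by (intro power_mono) auto
    finally have A: "3 / 4 \<le> measure (P_measure \<theta>) A"
      using Nr unfolding A_def measure_P_measure_cylinder[OF \<theta>(1)] by simp
    have "1 / L \<le> \<theta> M"
      using rat_prob_vector_ge[OF dom'(2) Z(2)] close[OF rat_prob_vector_in_S_inf \<theta>, of M]
        \<open>r \<le> 1 / L\<close> unfolding Z2 by simp
    have "measure (vector_measure \<theta>) (- {M}) = 1 - \<theta> M"
      using prob_space.prob_compl[OF prob_space_vector_measure[OF \<theta>(1)], of "{M}"]
      by (simp add: measure_vector_measure_singleton[OF \<theta>(1)] Compl_eq_Diff_UNIV)
    then have "measure (P_measure \<theta>) C = (1 - \<theta> M) ^ N"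
      unfolding C_def measure_P_measure_cylinder[OF \<theta>(1)] by simp
    \<comment> \<open>Uses 1 - x \<le> exp (- x) at x = 1 / \<open>L\<close>; as \<open>N\<close> =
      2 * \<open>L\<close>, the power becomes exp (- 2).\<close>
    also have "\<dots> \<le> (exp (- (1 / L))) ^ N"
      using \<theta>(1) \<open>1 / L \<le> \<theta> M\<close> exp_ge_add_one_self[of "- (1 / L)"]
      by (intro power_mono) (auto simp: S_inf_def)
    also have "\<dots> = exp (- 2)"
      using L L4 by (simp add: exp_of_nat_mult[symmetric])
    also have "\<dots> < 1 / 4"
    proof -
      have "5 \<le> exp (2::real)"
        using exp_lower_Taylor_quadratic[of 2] by simp
      then show ?thesis by (simp add: exp_minus field_simps)
    qed
    finally have C: "measure (P_measure \<theta>) C < 1 / 4" .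
    have "measure (P_measure \<theta>) A \<le> measure (P_measure \<theta>) ((A - C) \<union> C)"
      using AC by (intro Pm.finite_measure_mono) auto
    also have "\<dots> \<le> measure (P_measure \<theta>) (A - C) + measure (P_measure \<theta>) C"
      using AC by (intro measure_Un_le) auto
    finally show ?thesis using A C by simp
  qed
  with post AC show ?thesis by (intro bexI[of _ "A - C"]) auto
qed

section \<open>Generic inconsistency\<close>

text \<open>The tail unions \<open>S n\<close> decrease and have probability at least 1/2, hence so
  does their intersection. There the posterior of \<open>U\<close> exceeds 1/2 infinitely often,
  whereas consistency would make it tend to 0 almost surely.\<close>

lemma not_classically_consistentI:
  assumes \<theta>: "\<theta> \<in> S_inf" and U: "openin (top_of_set S_inf) U" "\<theta> \<notin> U"
    and often: "\<And>n. \<exists>N\<ge>n. \<exists>E\<in>sets (P_measure \<theta>). 1 / 2 < measure (P_measure \<theta>) E \<and>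
      (\<forall>x\<in>E. 1 / 2 < posterior p U (map x [0..<N]))"
  shows "\<not> classically_consistent p \<theta>"
proof
  assume "classically_consistent p \<theta>"
  then have ae: "AE x in P_measure \<theta>. (\<lambda>n. posterior p U (map x [0..<n])) \<longlonglongrightarrow> 0"
    using U by (fastforce simp: classically_consistent_def)
  interpret P: prob_space "P_measure \<theta>" using \<theta> by (rule prob_space_P_measure)
  obtain N E where NE: "\<And>n. n \<le> N n" "\<And>n. E n \<in> P.events" "\<And>n. 1 / 2 < P.prob (E n)"
      "\<And>n x. x \<in> E n \<Longrightarrow> 1 / 2 < posterior p U (map x [0..<N n])"
    using often by metis
  define S where "S n = (\<Union>k\<in>{n..}. E k)" for n
  have S: "S n \<in> P.events" for n
    using NE(2) by (auto simp: S_def)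
  have "(\<lambda>n. P.prob (S n)) \<longlonglongrightarrow> P.prob (\<Inter>n. S n)"
    using S by (intro P.finite_Lim_measure_decseq) (fastforce simp: decseq_def S_def)+
  moreover have "1 / 2 \<le> P.prob (S n)" for n
    using P.finite_measure_mono[of "E n" "S n"] S NE(3)[of n] by (force simp: S_def)
  ultimately have "1 / 2 \<le> P.prob (\<Inter>n. S n)"
    by (intro LIMSEQ_le_const) auto
  moreover have "AE x in P_measure \<theta>. x \<notin> (\<Inter>n. S n)"
    using ae
  proof eventually_elim
    case (elim x)
    then have "\<forall>\<^sub>F n in sequentially. posterior p U (map x [0..<n]) < 1 / 2"
      by (rule order_tendstoD) simp
    then obtain n where n: "\<And>k. n \<le> k \<Longrightarrow> posterior p U (map x [0..<k]) < 1 / 2"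
      by (auto simp: eventually_sequentially)
    have "x \<notin> E k" if "n \<le> k" for k
      using n[of "N k"] NE(1)[of k] NE(4)[of x k] that by fastforce
    then show ?case by (auto simp: S_def)
  qed
  ultimately show False
    using P.prob_eq_0[of "\<Inter>n. S n"] S by auto
qed

lemma mem_Union_Collect2: "y \<in> \<Union> {f i j | i j. P i j} \<longleftrightarrow> (\<exists>i j. P i j \<and> y \<in> f i j)"
  by blast

theorem theorem1p13:
  shows "effectively_comeager (prod_presented (prob_presented S_inf_space) S_inf_space)
    {(p, \<theta>). p \<in> prob_measures S_inf_metric \<and> \<theta> \<in> S_inf \<and> \<not> classically_consistent p \<theta>}"
proof -
  let ?X = "prod_presented (prob_presented S_inf_space) S_inf_space"
  let ?q = rat_prob_vector
  have met: "met ?X = prod_metric (prokhorov_metric S_inf_metric) S_inf_metric"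
    by (simp add: prod_presented_def prob_presented_def S_inf_space_def)
  have ideal: "ideal ?X i = (mixture (?q (fst (prod_decode i))), ?q (snd (prod_decode i)))" for i
    by (simp add: prod_presented_def case_prod_unfold ideal_prob_presented_S_inf)
       (simp add: S_inf_space_def)
  have ideal_in: "ideal ?X i \<in> prob_measures S_inf_metric \<times> S_inf" for i
    by (simp add: ideal mixture_in_prob_measures rat_prob_vector_in_S_inf)
  interpret X: Metric_space "prob_measures S_inf_metric \<times> S_inf"
      "prod_dist (prokhorov_dist S_inf_metric) l1_dist"
    using Metric_space_mspace_mdist[of "met ?X"] by (simp add: met)
  have mb: "mball_of (met ?X) = X.mball" and mt: "mtopology_of (met ?X) = X.mtopology"
    by (simp_all add: mball_of_def mtopology_of_def met)
  have mspace_X: "mspace (met ?X) = prob_measures S_inf_metric \<times> S_inf" by (simp add: met)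
  define W where "W n =
      \<Union> {mball_of (met ?X) (ideal ?X i) (rat_radius j) | i j. ball_relation [n, i, j]}" for n
  have W_iff: "y \<in> W n \<longleftrightarrow>
      (\<exists>i j. ball_relation [n, i, j] \<and> y \<in> X.mball (ideal ?X i) (rat_radius j))" for y n
    unfolding W_def mb mem_Union_Collect2 ..
  have "computable_ce_open_seq ?X W"
    unfolding computable_ce_open_seq_def using ce_ball_relation W_def
    by (intro exI[of _ ball_relation] conjI allI)
  moreover have "mtopology_of (met ?X) closure_of W n = mspace (met ?X)" for n
  proof -
    \<comment> \<open>Each ball contains its own centre, so density of \<open>W n\<close> reduces to
      density of dominated ideal points.\<close>
    have "\<exists>y\<in>W n. y \<in> X.mball (p, \<theta>) \<epsilon>"
      if p: "p \<in> prob_measures S_inf_metric" and \<theta>: "\<theta> \<in> S_inf" and \<epsilon>: "0 < \<epsilon>" for p \<theta> \<epsilon>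
    proof -
      obtain pc tc k M where dom: "dominant (n mod 2) pc tc k M"
        and d: "prokhorov_dist S_inf_metric p (mixture (?q pc)) < \<epsilon> / 2" "l1_dist \<theta> (?q tc) < \<epsilon> / 2"
        using dominant_dense[OF p \<theta>, of "\<epsilon> / 2" "n mod 2"] \<epsilon> by auto
      define i where "i = prod_encode (pc, tc)"
      define j where "j = radius_code (2 * (n + i + 2))"
      have "ball_relation [n, i, j]"
        using dom unfolding ball_relation_def by (simp add: i_def j_def) blast
      moreover have "0 < rat_radius j"
        unfolding j_def rat_radius_radius_code by (intro divide_pos_pos add_nonneg_pos) auto
      then have "ideal ?X i \<in> X.mball (ideal ?X i) (rat_radius j)"
        using ideal_in[of i] by simp
      ultimately have "ideal ?X i \<in> W n"
        unfolding W_iff by (intro exI conjI)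
      moreover have "prod_dist (prokhorov_dist S_inf_metric) l1_dist (p, \<theta>) (ideal ?X i) < \<epsilon>"
      proof -
        have "prod_dist (prokhorov_dist S_inf_metric) l1_dist (p, \<theta>) (ideal ?X i)
            \<le> prokhorov_dist S_inf_metric p (mixture (?q pc)) + l1_dist \<theta> (?q tc)"
          unfolding prod_dist_def ideal i_def
          by (simp add: sqrt_sum_squares_le_sum[OF Metric_space.nonneg[OF Metric_space_prokhorov]
                Metric_space.nonneg[OF Metric_space_S_inf]])
        with d show ?thesis by simp
      qed
      ultimately show ?thesis
        using ideal_in[of i] p \<theta> by (intro bexI[of _ "ideal ?X i"]) simp_all
    qed
    then have "\<forall>x\<in>prob_measures S_inf_metric \<times> S_inf. \<forall>\<epsilon>>0. \<exists>y\<in>W n. y \<in> X.mball x \<epsilon>"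
      unfolding split_paired_Ball_Sigma by blast
    then show ?thesis
      unfolding mt X.metric_closure_of mspace_X by blast
  qed
  moreover have "\<not> classically_consistent p \<theta>" and "p \<in> prob_measures S_inf_metric" and "\<theta> \<in> S_inf"
    if W: "(p, \<theta>) \<in> (\<Inter>n. W n)" for p \<theta>
  proof -
    have "(p, \<theta>) \<in> W 0" using W by blast
    then have "(p, \<theta>) \<in> prob_measures S_inf_metric \<times> S_inf"
      unfolding W_iff X.in_mball by blast
    then show p: "p \<in> prob_measures S_inf_metric" and \<theta>: "\<theta> \<in> S_inf"
      by simp_all
    define Q where "Q b N \<longleftrightarrow> (\<exists>E\<in>sets (P_measure \<theta>). 1 / 2 < measure (P_measure \<theta>) E \<and>
        (\<forall>x\<in>E. 1 / 2 < posterior p (target b) (map x [0..<N])))" for b N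
    have often: "\<exists>N\<ge>n. Q (n mod 2) N" for n
    proof -
      obtain i j where ij: "ball_relation [n, i, j]" "(p, \<theta>) \<in> X.mball (ideal ?X i) (rat_radius j)"
        using W unfolding INT_iff W_iff by blast
      define pc where "pc = fst (prod_decode i)"
      define tc where "tc = snd (prod_decode i)"
      \<comment> \<open>\<open>i\<close> bounds both components of the pair it codes,
        \<open>n\<close> makes the sample size 4 * \<open>Z\<close> grow, and the summand 2 gives
        \<open>2 \<le> Z\<close>.\<close>
      define Z where "Z = n + i + 2"
      obtain k M where dom: "dominant (n mod 2) pc tc k M" and j: "j = radius_code (2 * Z)"
        using ij(1) by (auto simp: ball_relation_def pc_def tc_def Z_def)
      have "i = prod_encode (pc, tc)"
        by (simp add: pc_def tc_def)
      then have Z: "pc \<le> Z" "tc \<le> Z" "2 \<le> Z"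
        using le_prod_encode_1[of pc tc] le_prod_encode_2[of tc pc] by (auto simp: Z_def)
      have r: "rat_radius j = 1 / (2 * (2 * real Z) ^ (4 * Z + 1) + 1)"
        unfolding j rat_radius_radius_code by simp
      have "prod_dist (prokhorov_dist S_inf_metric) l1_dist (mixture (?q pc), ?q tc) (p, \<theta>) < rat_radius j"
        using ij(2) by (simp add: ideal pc_def tc_def)
      then have "prokhorov_dist S_inf_metric (mixture (?q pc)) p < rat_radius j"
        "l1_dist (?q tc) \<theta> < rat_radius j"
        unfolding prod_dist_def by (auto intro: order_le_less_trans[OF real_sqrt_sum_squares_ge1]
            order_le_less_trans[OF real_sqrt_sum_squares_ge2])
      from dominant_imp_posterior[OF dom Z refl refl r p this(1) \<theta> this(2)]
      have "Q (n mod 2) (4 * Z)" unfolding Q_def .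
      moreover have "n \<le> 4 * Z" by (simp add: Z_def)
      ultimately show ?thesis by blast
    qed
    have frequently: "\<exists>N\<ge>n. Q b N" if "b < 2" for b n
    proof -
      \<comment> \<open>Stage 2 * \<open>n\<close> + \<open>b\<close> is at least \<open>n\<close>
        and has the parity that selects \<open>target b\<close>.\<close>
      have "(2 * n + b) mod 2 = b" using that by simp
      then obtain N where "2 * n + b \<le> N" "Q b N" using often[of "2 * n + b"] by auto
      then show ?thesis by (intro exI[of _ N]) simp
    qed
    \<comment> \<open>The two targets are disjoint, so \<theta> misses one of them.\<close>
    obtain b where b: "b < 2" "\<theta> \<notin> target b"
    proof (cases "\<theta> \<in> target 0")
      case True
      then show ?thesis using that[of 1] by (simp add: target_def)
    next
      case False
      then show ?thesis using that[of 0] by simp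
    qed
    show "\<not> classically_consistent p \<theta>"
      using frequently[OF b(1)] unfolding Q_def
      by (rule not_classically_consistentI[OF \<theta> openin_target b(2)])
  qed
  ultimately show ?thesis
    unfolding effectively_comeager_def by (intro conjI exI[of _ W]) (auto simp: met)
qed

end
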